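(* Let $X$ be a projective rational complexity-one $T$-variety, $D$ a $T$-invariant divisor on $X$, and $\mathcal{D}=\sum_{i=0}^m\Delta_i P_i$ the polyhedral divisor on $\mathbb{P}^1$ encoding the affine rational complexity-one $(T\times\mathbb{K}^* )$-variety $\mathrm{Spec}\,R(\mathcal{O}(D))$. Let $\mathfrak{v}=\mathfrak{v}_{(\psi,Q,\gamma)}$ be an $M$-homogeneous valuation on $\mathbb{K}(X)$ with $Q=P_j$. Then the Newton-Okounkov body of $D$ with respect to $\mathfrak{v}$ is the image of $$\Big\{(u,v)\in\Box_D\times\mathbb{R}\ \Big|\ -\Delta_j(1,u)\le v\le\sum_{i\ne j}\Delta_i(1,u)\Big\}$$ under the map $\rho:(M\times\mathbb{Z})_\mathbb{R}\to\Gamma_\mathbb{R}$ given by $(u,\lambda)\mapsto\psi(u)+\lambda\cdot\gamma$.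
   Context: $\mathbb{K}$ is an algebraically closed field; $T$ is an algebraic torus with character lattice $M$ and cocharacter lattice $N$. A $T$-variety is a normal irreducible variety with effective $T$-action; complexity one means $\dim T=\dim X-1$. $R(\mathcal{O}(D))=\bigoplus_{k\ge0}H^0(X,\mathcal{O}(kD))$; it is $\mathbb{Z}\times M$-graded, and $\mathrm{Spec}\,R(\mathcal{O}(D))$ is taken to be an affine rational complexity-one $(T\times\mathbb{K}^* )$-variety encoded by the polyhedral divisor $\mathcal{D}=\sum_{i=0}^m\Delta_iP_i$. This means: $P_0,\dots,P_m\in\mathbb{P}^1$ are distinct points; $\sigma\subset(\mathbb{Z}\times N)_\mathbb{Q}$ is a pointed polyhedral cone; each $\Delta_i$ is either empty or a polyhedron in $(\mathbb{Z}\times N)_\mathbb{Q}$ with tailcone $\{v:\Delta_i+v\subseteq\Delta_i\}=\sigma$; $\sum_i\Delta_i\subsetneq\sigma$; for $w\in\sigma^\vee$, $\Delta_i(w)=\min_{v\in\Delta_i}\langle v,w\rangle$ ($\infty$ if $\Delta_i=\emptyset$); and, fixing a $T$-equivariant identification of $\mathbb{K}(X)$ with the fraction field of $\mathbb{K}(\mathbb{P}^1)[M]$, the $(k,u)$-graded piece of $R(\mathcal{O}(D))$ is $$H^0(X,\mathcal{O}(kD))_u=H^0\Big(\mathbb{P}^1,\mathcal{O}\big(\textstyle\sum_i\lfloor\Delta_i(k,u)\rfloor P_i\big)\Big)\cdot\chi^u\subset\mathbb{K}(X)$$ for $(k,u)\in\sigma^\vee\cap(\mathbb{Z}\times M)$,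 and is zero otherwise. Put $\Box_D=\{u\in M_\mathbb{R}\mid(1,u)\in\sigma^\vee\}$ (with $\sigma^\vee$ viewed in $(\mathbb{Z}\times M)_\mathbb{R}$). Let $\Gamma$ be a totally ordered finitely generated free abelian group, $\psi:M\to\Gamma$ a homomorphism, $Q\in\mathbb{P}^1$, $\gamma\in\Gamma$, $\gamma\ge0$. The $M$-homogeneous valuation $\mathfrak{v}_{(\psi,Q,\gamma)}$ on $\mathbb{K}(X)$ is determined by $f\cdot\chi^u\mapsto\psi(u)+\mathrm{ord}_Q(f)\cdot\gamma$ for $f\in\mathbb{K}(\mathbb{P}^1)^*$, $u\in M$ (on $\mathbb{K}(\mathbb{P}^1)[M]$ it is the minimum over homogeneous components, and it is extended to the fraction field). Newton-Okounkov body: let $\mathfrak{v}_D$ be the homogeneous valuation on $R(\mathcal{O}(D))$ with values in $\mathbb{Z}\times\Gamma$ given by $\mathfrak{v}_D(s)=(k,\mathfrak{v}(s))$ for $0\ne s\in H^0(X,\mathcal{O}(kD))$, and let $C(R,\mathfrak{v}_D)\subset(\mathbb{Z}\times\Gamma)_\mathbb{R}$ be the closure of the positive hull of its set of values. The Newton-Okounkov body of $D$ with respect to $\mathfrak{v}$ is $\pi_2\big(C(R,\mathfrak{v}_D)\cap\pi_1^{-1}(1)\big)$, where $\pi_1,\pi_2$ are the projections of $(\mathbb{Z}\times\Gamma)_\mathbb{R}$ to $\mathbb{Z}_\mathbb{R}=\mathbb{R}$ and $\Gamma_\mathbb{R}$. *)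

theory Defs
  imports
    "HOL-Analysis.Analysis"
    "HOL-Library.Poly_Mapping"
    "HOL-Computational_Algebra.Computational_Algebra"
begin

section \<open>Lattices and ordered lattices\<close>

text \<open>
  A finitely generated free abelian group \<open>L\<close> is realised inside a Euclidean space as the
  \<open>\<int>\<close>-span of a linearly independent set, so that \<open>span L\<close> is \<open>L\<^sub>\<real>\<close>.  The basis
  need not span the ambient space, so that every rank, including 0, is covered.
\<close>

definition is_lattice :: "'a::euclidean_space set \<Rightarrow> bool" where
  "is_lattice L \<longleftrightarrow>
     (\<exists>B. independent B \<and> L = range (\<lambda>c::'a \<Rightarrow> int. \<Sum>b\<in>B. of_int (c b) *\<^sub>R b))"

definition total_group_order :: "'a::ab_group_add set \<Rightarrow> ('a \<Rightarrow> 'a \<Rightarrow> bool) \<Rightarrow> bool" where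
  "total_group_order G le \<longleftrightarrow>
     (\<forall>x\<in>G. le x x) \<and>
     (\<forall>x\<in>G. \<forall>y\<in>G. le x y \<and> le y x \<longrightarrow> x = y) \<and>
     (\<forall>x\<in>G. \<forall>y\<in>G. \<forall>z\<in>G. le x y \<and> le y z \<longrightarrow> le x z) \<and>
     (\<forall>x\<in>G. \<forall>y\<in>G. le x y \<or> le y x) \<and>
     (\<forall>x\<in>G. \<forall>y\<in>G. \<forall>z\<in>G. le x y \<longrightarrow> le (x + z) (y + z))"


section \<open>The projective line\<close>

datatype 'k proj_line = Aff 'k | Infty

text \<open>The rational function field \<open>K(P\<^sup>1)\<close> is \<open>'k poly fract\<close>.  Only meaningful for \<open>f \<noteq> 0\<close>.\<close>

definition ord_at :: "'k::field proj_line \<Rightarrow> 'k poly fract \<Rightarrow> int" where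
  "ord_at Q f = (THE n. \<exists>p q. p \<noteq> 0 \<and> q \<noteq> 0 \<and> f = Fraction_Field.Fract p q \<and>
     n = (case Q of Aff a \<Rightarrow> int (order a p) - int (order a q)
                  | Infty \<Rightarrow> int (degree q) - int (degree p)))"

text \<open>A coefficient \<open>\<infinity>\<close> allows poles of any order.\<close>

definition H0_P1 :: "('k::field proj_line \<Rightarrow> ereal) \<Rightarrow> 'k poly fract set" where
  "H0_P1 E = {f. f \<noteq> 0 \<longrightarrow> (\<forall>Q. 0 \<le> ereal (of_int (ord_at Q f)) + E Q)}"

definition ereal_floor :: "ereal \<Rightarrow> ereal" where
  "ereal_floor x = (case x of ereal r \<Rightarrow> ereal (of_int \<lfloor>r\<rfloor>) | _ \<Rightarrow> x)"


section \<open>Subrings of a field and local rings\<close>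

definition is_subring :: "'r::comm_ring_1 set \<Rightarrow> bool" where
  "is_subring A \<longleftrightarrow> 1 \<in> A \<and> (\<forall>x\<in>A. \<forall>y\<in>A. x - y \<in> A \<and> x * y \<in> A)"

definition is_prime_ideal :: "'r::comm_ring_1 set \<Rightarrow> 'r set \<Rightarrow> bool" where
  "is_prime_ideal A p \<longleftrightarrow>
     p \<subseteq> A \<and> 0 \<in> p \<and> (\<forall>x\<in>p. \<forall>y\<in>p. x + y \<in> p) \<and> (\<forall>a\<in>A. \<forall>x\<in>p. a * x \<in> p) \<and>
     1 \<notin> p \<and> (\<forall>a\<in>A. \<forall>b\<in>A. a * b \<in> p \<longrightarrow> a \<in> p \<or> b \<in> p)"

definition localization :: "'f::field set \<Rightarrow> 'f set \<Rightarrow> 'f set" where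
  "localization A p = {a / b | a b. a \<in> A \<and> b \<in> A - p}"

definition nonunits :: "'f::field set \<Rightarrow> 'f set" where
  "nonunits A = {x \<in> A. x = 0 \<or> inverse x \<notin> A}"

definition integrally_closed :: "'f::field set \<Rightarrow> bool" where
  "integrally_closed A \<longleftrightarrow>
     (\<forall>x. (\<exists>p. lead_coeff p = 1 \<and> (\<forall>i. coeff p i \<in> A) \<and> poly p x = 0) \<longrightarrow> x \<in> A)"


section \<open>Projective varieties with a given function field\<close>

text \<open>
  A variety with function field \<open>'f\<close> is given by the set of the local rings of all its
  scheme-theoretic points, as subrings of \<open>'f\<close> (points of an integral separated scheme are
  determined by their local rings).  The map \<open>\<kappa>\<close> is the inclusion of the ground field.
\<close>

definition algebra_gen :: "('k \<Rightarrow> 'f::field) \<Rightarrow> 'f set \<Rightarrow> 'f set" where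
  "algebra_gen \<kappa> S = (\<lambda>A. is_subring A \<and> range \<kappa> \<subseteq> A) hull S"

definition affine_model :: "'f::field set \<Rightarrow> 'f set set" where
  "affine_model A = {localization A p | p. is_prime_ideal A p}"

text \<open>
  The elements of \<open>S\<close> are, up to a common factor, the restrictions of the homogeneous coordinates
  of a projective embedding (those not vanishing identically), so that the standard affine
  charts have the coordinate rings \<open>K[x/y | x \<in> S]\<close>, \<open>y \<in> S\<close>.
\<close>

definition projective_variety :: "('k \<Rightarrow> 'f::field) \<Rightarrow> 'f set set \<Rightarrow> bool" where
  "projective_variety \<kappa> X \<longleftrightarrow>
     (\<exists>S. finite S \<and> S \<noteq> {} \<and> 0 \<notin> S \<and>
        (\<forall>y\<in>S. localization (algebra_gen \<kappa> {x / y | x. x \<in> S}) {0} = UNIV) \<and>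
        X = (\<Union>y\<in>S. affine_model (algebra_gen \<kappa> {x / y | x. x \<in> S})))"

definition normal_variety :: "'f::field set set \<Rightarrow> bool" where
  "normal_variety X \<longleftrightarrow> (\<forall>A\<in>X. integrally_closed A)"

text \<open>A prime divisor is a point of codimension one, i.e. one whose local ring has dimension one.\<close>

definition prime_divisor :: "'f::field set set \<Rightarrow> 'f set \<Rightarrow> bool" where
  "prime_divisor X A \<longleftrightarrow>
     A \<in> X \<and> A \<noteq> UNIV \<and> (\<forall>p. is_prime_ideal A p \<longrightarrow> p = {0} \<or> p = nonunits A)"

text \<open>The order of \<open>f \<noteq> 0\<close> along a prime divisor; \<open>z\<close> is a local equation of the divisor.\<close>

definition ord_along :: "'f::field set \<Rightarrow> 'f \<Rightarrow> int" where
  "ord_along A f = (THE n. \<exists>z e. nonunits A = {z * a | a. a \<in> A} \<and>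
     e \<in> A - nonunits A \<and> f = e * z powi n)"

definition weil_divisor :: "'f::field set set \<Rightarrow> ('f set \<Rightarrow> int) \<Rightarrow> bool" where
  "weil_divisor X D \<longleftrightarrow> finite {A. D A \<noteq> 0} \<and> (\<forall>A. D A \<noteq> 0 \<longrightarrow> prime_divisor X A)"

definition H0 :: "'f::field set set \<Rightarrow> ('f set \<Rightarrow> int) \<Rightarrow> 'f set" where
  "H0 X D = {f. f \<noteq> 0 \<longrightarrow> (\<forall>A. prime_divisor X A \<longrightarrow> 0 \<le> ord_along A f + D A)}"

text \<open>The \<open>\<int>\<close>-graded pieces of \<open>R(\<O>(D))\<close>.\<close>

definition section_ring :: "'f::field set set \<Rightarrow> ('f set \<Rightarrow> int) \<Rightarrow> int \<Rightarrow> 'f set" where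
  "section_ring X D k = (if 0 \<le> k then H0 X (\<lambda>A. k * D A) else {0})"


section \<open>Torus actions of complexity one\<close>

text \<open>
  \<open>group_algebra R M\<close> is \<open>R[M]\<close>.  The field \<open>'f\<close> is identified with \<open>Frac K(P\<^sup>1)[M]\<close> by an
  embedding \<open>\<iota>\<close> of \<open>K(P\<^sup>1)\<close> and the characters \<open>\<xi> u\<close>, \<open>u \<in> M\<close>; values of \<open>\<xi>\<close> outside \<open>M\<close>
  are irrelevant.
\<close>

definition group_algebra :: "'r::zero set \<Rightarrow> 'm set \<Rightarrow> ('m \<Rightarrow>\<^sub>0 'r) set" where
  "group_algebra R M = {a. Poly_Mapping.keys a \<subseteq> M \<and> (\<forall>u. Poly_Mapping.lookup a u \<in> R)}"

definition realize :: "('k::field poly fract \<Rightarrow> 'f::field) \<Rightarrow> ('m \<Rightarrow> 'f) \<Rightarrow> ('m \<Rightarrow>\<^sub>0 'k poly fract) \<Rightarrow> 'f"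
  where "realize \<iota> \<xi> a = (\<Sum>u\<in>Poly_Mapping.keys a. \<iota> (Poly_Mapping.lookup a u) * \<xi> u)"

definition function_field_identification ::
  "'m::ab_group_add set \<Rightarrow> ('k::field poly fract \<Rightarrow> 'f::field) \<Rightarrow> ('m \<Rightarrow> 'f) \<Rightarrow> bool" where
  "function_field_identification M \<iota> \<xi> \<longleftrightarrow>
     \<iota> 1 = 1 \<and> (\<forall>f g. \<iota> (f + g) = \<iota> f + \<iota> g \<and> \<iota> (f * g) = \<iota> f * \<iota> g) \<and>
     \<xi> 0 = 1 \<and> (\<forall>u\<in>M. \<forall>u'\<in>M. \<xi> (u + u') = \<xi> u * \<xi> u') \<and>
     (\<forall>a\<in>group_algebra UNIV M. realize \<iota> \<xi> a = 0 \<longrightarrow> a = 0) \<and>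
     (\<forall>x. \<exists>a\<in>group_algebra UNIV M. \<exists>b\<in>group_algebra UNIV M.
        b \<noteq> 0 \<and> x = realize \<iota> \<xi> a / realize \<iota> \<xi> b)"

definition constants :: "('k::field poly fract \<Rightarrow> 'f) \<Rightarrow> 'k \<Rightarrow> 'f" where
  "constants \<iota> c = \<iota> (Fraction_Field.Fract [:c:] 1)"

text \<open>
  The rational action of \<open>T = Spec K[M]\<close> with \<open>K(P\<^sup>1)\<close> invariant and \<open>\<xi> u\<close> of weight \<open>u\<close> has
  comorphism \<open>f \<cdot> \<xi> u \<mapsto> (f \<cdot> \<xi> u) \<otimes> u\<close>, with values in \<open>'f[M]\<close> on \<open>K(P\<^sup>1)[M]\<close>.  It is automatically
  effective and its field of invariants is \<open>K(P\<^sup>1)\<close>.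
\<close>

definition coaction ::
  "('k::field poly fract \<Rightarrow> 'f::field) \<Rightarrow> ('m \<Rightarrow> 'f) \<Rightarrow> ('m \<Rightarrow>\<^sub>0 'k poly fract) \<Rightarrow> ('m \<Rightarrow>\<^sub>0 'f)" where
  "coaction \<iota> \<xi> a = (\<Sum>u\<in>Poly_Mapping.keys a. Poly_Mapping.single u (\<iota> (Poly_Mapping.lookup a u) * \<xi> u))"

text \<open>
  The action is a morphism \<open>T \<times> X \<rightarrow> X\<close> iff every local ring of \<open>T \<times> X\<close> dominates, via the
  comorphism, a local ring of \<open>X\<close>.  The local rings of \<open>T \<times> X\<close> are the localizations of the
  rings \<open>A[M]\<close>, \<open>A \<in> X\<close>, at prime ideals \<open>p\<close>.  The equation says that the comorphism maps
  \<open>g = a / b\<close> to \<open>r / s\<close>, without forming the fraction field of \<open>'f[M]\<close>.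
\<close>

definition regular_torus_action ::
  "'m::ab_group_add set \<Rightarrow> ('k::field poly fract \<Rightarrow> 'f::field) \<Rightarrow> ('m \<Rightarrow> 'f) \<Rightarrow> 'f set set \<Rightarrow> bool" where
  "regular_torus_action M \<iota> \<xi> X \<longleftrightarrow>
     (\<forall>A\<in>X. \<forall>p. is_prime_ideal (group_algebra A M) p \<longrightarrow>
        (\<exists>A'\<in>X. \<forall>g\<in>A'.
           \<exists>a\<in>group_algebra UNIV M. \<exists>b\<in>group_algebra UNIV M.
           \<exists>r\<in>group_algebra A M. \<exists>s\<in>group_algebra A M - p.
             b \<noteq> 0 \<and> g = realize \<iota> \<xi> a / realize \<iota> \<xi> b \<and>
             coaction \<iota> \<xi> a * s = r * coaction \<iota> \<xi> b \<and>
             (g \<in> nonunits A' \<longrightarrow> r \<in> p)))"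

text \<open>
  Normality, projectivity and regularity of the action; rationality, effectiveness and complexity
  one are contained in \<^const>\<open>function_field_identification\<close>.
\<close>

definition projective_rational_complexity_one_T_variety ::
  "'m::ab_group_add set \<Rightarrow> ('k::field poly fract \<Rightarrow> 'f::field) \<Rightarrow> ('m \<Rightarrow> 'f) \<Rightarrow> 'f set set \<Rightarrow> bool" where
  "projective_rational_complexity_one_T_variety M \<iota> \<xi> X \<longleftrightarrow>
     function_field_identification M \<iota> \<xi> \<and>
     projective_variety (constants \<iota>) X \<and> normal_variety X \<and> regular_torus_action M \<iota> \<xi> X"

text \<open>\<open>\<tau>\<close> is the automorphism of the function field induced by the point \<open>t \<in> T(K) = Hom(M, K\<^sup>*)\<close>.\<close>

definition torus_automorphism ::
  "'m::ab_group_add set \<Rightarrow> ('k::field poly fract \<Rightarrow> 'f::field) \<Rightarrow> ('m \<Rightarrow> 'f) \<Rightarrow>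
   ('m \<Rightarrow> 'k) \<Rightarrow> ('f \<Rightarrow> 'f) \<Rightarrow> bool" where
  "torus_automorphism M \<iota> \<xi> t \<tau> \<longleftrightarrow>
     (\<forall>u\<in>M. t u \<noteq> 0) \<and> (\<forall>u\<in>M. \<forall>u'\<in>M. t (u + u') = t u * t u') \<and>
     (\<forall>x y. \<tau> (x + y) = \<tau> x + \<tau> y \<and> \<tau> (x * y) = \<tau> x * \<tau> y) \<and>
     (\<forall>f. \<tau> (\<iota> f) = \<iota> f) \<and> (\<forall>u\<in>M. \<tau> (\<xi> u) = constants \<iota> (t u) * \<xi> u)"

definition T_invariant_divisor ::
  "'m::ab_group_add set \<Rightarrow> ('k::field poly fract \<Rightarrow> 'f::field) \<Rightarrow> ('m \<Rightarrow> 'f) \<Rightarrow>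
   'f set set \<Rightarrow> ('f set \<Rightarrow> int) \<Rightarrow> bool" where
  "T_invariant_divisor M \<iota> \<xi> X D \<longleftrightarrow>
     weil_divisor X D \<and>
     (\<forall>t \<tau>. torus_automorphism M \<iota> \<xi> t \<tau> \<longrightarrow> (\<forall>A. prime_divisor X A \<longrightarrow> D (\<tau> ` A) = D A))"


section \<open>Polyhedral divisors on the projective line\<close>

text \<open>
  The inner product identifies \<open>N\<^sub>\<real>\<close> with \<open>span M\<close>, with \<open>N\<close> the dual lattice of \<open>M\<close>; the following
  is \<open>(\<int> \<times> N)\<^sub>\<rat>\<close>.
\<close>

definition rat_cochars :: "'m::euclidean_space set \<Rightarrow> (real \<times> 'm) set" where
  "rat_cochars M = {v. fst v \<in> \<rat> \<and> snd v \<in> span M \<and> (\<forall>u\<in>M. snd v \<bullet> u \<in> \<rat>)}"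

definition rat_polyhedron :: "'m::euclidean_space set \<Rightarrow> (real \<times> 'm) set \<Rightarrow> bool" where
  "rat_polyhedron M \<Delta> \<longleftrightarrow>
     (\<exists>H. finite H \<and> H \<subseteq> (\<int> \<times> M) \<times> \<rat> \<and> \<Delta> = {v \<in> rat_cochars M. \<forall>(w, c)\<in>H. c \<le> v \<bullet> w})"

definition rat_polyhedral_cone :: "'m::euclidean_space set \<Rightarrow> (real \<times> 'm) set \<Rightarrow> bool" where
  "rat_polyhedral_cone M \<sigma> \<longleftrightarrow>
     (\<exists>H. finite H \<and> H \<subseteq> \<int> \<times> M \<and> \<sigma> = {v \<in> rat_cochars M. \<forall>w\<in>H. 0 \<le> v \<bullet> w})"

definition pointed :: "'a::ab_group_add set \<Rightarrow> bool" where
  "pointed \<sigma> \<longleftrightarrow> (\<forall>v. v \<in> \<sigma> \<and> - v \<in> \<sigma> \<longrightarrow> v = 0)"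

definition tailcone :: "'m::euclidean_space set \<Rightarrow> (real \<times> 'm) set \<Rightarrow> (real \<times> 'm) set" where
  "tailcone M \<Delta> = {v \<in> rat_cochars M. \<forall>d\<in>\<Delta>. d + v \<in> \<Delta>}"

text \<open>The cone \<open>\<sigma>\<^sup>\<or>\<close> in \<open>(\<int> \<times> M)\<^sub>\<real>\<close>.\<close>

definition dual_cone :: "'m::euclidean_space set \<Rightarrow> (real \<times> 'm) set \<Rightarrow> (real \<times> 'm) set" where
  "dual_cone M \<sigma> = {w \<in> UNIV \<times> span M. \<forall>v\<in>\<sigma>. 0 \<le> v \<bullet> w}"

text \<open>\<open>\<Delta>(w)\<close>, which is \<open>\<infinity>\<close> for \<open>\<Delta> = {}\<close>; for \<open>w \<in> \<sigma>\<^sup>\<or>\<close> the infimum is attained.\<close>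

definition pd_eval :: "(real \<times> 'm::euclidean_space) set \<Rightarrow> real \<times> 'm \<Rightarrow> ereal" where
  "pd_eval \<Delta> w = (INF v\<in>\<Delta>. ereal (v \<bullet> w))"

definition polyhedral_divisor ::
  "'m::euclidean_space set \<Rightarrow> nat \<Rightarrow> (nat \<Rightarrow> 'k proj_line) \<Rightarrow> (real \<times> 'm) set \<Rightarrow>
   (nat \<Rightarrow> (real \<times> 'm) set) \<Rightarrow> bool" where
  "polyhedral_divisor M m P \<sigma> \<Delta> \<longleftrightarrow>
     inj_on P {..m} \<and> rat_polyhedral_cone M \<sigma> \<and> pointed \<sigma> \<and>
     (\<forall>i\<le>m. \<Delta> i = {} \<or> (rat_polyhedron M (\<Delta> i) \<and> tailcone M (\<Delta> i) = \<sigma>)) \<and>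
     {\<Sum>i\<le>m. v i | v. \<forall>i\<le>m. v i \<in> \<Delta> i} \<subset> \<sigma>"

text \<open>The coefficients in \<open>K(P\<^sup>1)\<close> of the \<open>(k,u)\<close>-graded piece.\<close>

definition pd_piece ::
  "'m::euclidean_space set \<Rightarrow> nat \<Rightarrow> (nat \<Rightarrow> 'k::field proj_line) \<Rightarrow> (real \<times> 'm) set \<Rightarrow>
   (nat \<Rightarrow> (real \<times> 'm) set) \<Rightarrow> int \<Rightarrow> 'm \<Rightarrow> 'k poly fract set" where
  "pd_piece M m P \<sigma> \<Delta> k u =
     (if (of_int k, u) \<in> dual_cone M \<sigma>
      then H0_P1 (\<lambda>Q. \<Sum>i | i \<le> m \<and> P i = Q. ereal_floor (pd_eval (\<Delta> i) (of_int k, u)))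
      else {0})"

text \<open>
  \<open>R(\<O>(D))\<close> is the \<open>\<int> \<times> M\<close>-graded ring given by the polyhedral divisor: \<open>H\<^sup>0(X, \<O>(kD))\<close> is the
  direct sum over \<open>u \<in> M\<close> of its pieces of degree \<open>(k,u)\<close>.
\<close>

definition encodes_section_ring ::
  "'m::euclidean_space set \<Rightarrow> ('k::field poly fract \<Rightarrow> 'f::field) \<Rightarrow> ('m \<Rightarrow> 'f) \<Rightarrow>
   'f set set \<Rightarrow> ('f set \<Rightarrow> int) \<Rightarrow> nat \<Rightarrow> (nat \<Rightarrow> 'k proj_line) \<Rightarrow> (real \<times> 'm) set \<Rightarrow>
   (nat \<Rightarrow> (real \<times> 'm) set) \<Rightarrow> bool" where
  "encodes_section_ring M \<iota> \<xi> X D m P \<sigma> \<Delta> \<longleftrightarrow>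
     polyhedral_divisor M m P \<sigma> \<Delta> \<and>
     (\<forall>k. section_ring X D k =
        realize \<iota> \<xi> ` {a \<in> group_algebra UNIV M. \<forall>u\<in>M. Poly_Mapping.lookup a u \<in> pd_piece M m P \<sigma> \<Delta> k u})"

definition box_D :: "'m::euclidean_space set \<Rightarrow> (real \<times> 'm) set \<Rightarrow> 'm set" where
  "box_D M \<sigma> = {u \<in> span M. (1, u) \<in> dual_cone M \<sigma>}"


section \<open>Homogeneous valuations and Newton-Okounkov bodies\<close>

text \<open>Only the values at nonzero arguments matter.\<close>

definition is_valuation :: "'g::ab_group_add set \<Rightarrow> ('g \<Rightarrow> 'g \<Rightarrow> bool) \<Rightarrow> ('f::field \<Rightarrow> 'g) \<Rightarrow> bool" where
  "is_valuation \<Gamma> le \<nu> \<longleftrightarrow>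
     (\<forall>x. x \<noteq> 0 \<longrightarrow> \<nu> x \<in> \<Gamma>) \<and>
     (\<forall>x y. x \<noteq> 0 \<and> y \<noteq> 0 \<longrightarrow> \<nu> (x * y) = \<nu> x + \<nu> y) \<and>
     (\<forall>x y. x \<noteq> 0 \<and> y \<noteq> 0 \<and> x + y \<noteq> 0 \<longrightarrow> le (\<nu> x) (\<nu> (x + y)) \<or> le (\<nu> y) (\<nu> (x + y)))"

text \<open>
  \<open>\<nu> = v\<^bsub>(\<psi>,Q,\<gamma>)\<^esub>\<close>: on \<open>K(P\<^sup>1)[M]\<close> it is the minimum over the homogeneous components, and
  multiplicativity then determines it on the fraction field.
\<close>

definition is_psi_Q_gamma_valuation ::
  "'m::ab_group_add set \<Rightarrow> ('k::field poly fract \<Rightarrow> 'f::field) \<Rightarrow> ('m \<Rightarrow> 'f) \<Rightarrow>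
   'g::real_vector set \<Rightarrow> ('g \<Rightarrow> 'g \<Rightarrow> bool) \<Rightarrow> ('m \<Rightarrow> 'g) \<Rightarrow> 'k proj_line \<Rightarrow> 'g \<Rightarrow> ('f \<Rightarrow> 'g) \<Rightarrow> bool" where
  "is_psi_Q_gamma_valuation M \<iota> \<xi> \<Gamma> le \<psi> Q \<gamma> \<nu> \<longleftrightarrow>
     is_valuation \<Gamma> le \<nu> \<and>
     (\<forall>a\<in>group_algebra UNIV M. a \<noteq> 0 \<longrightarrow>
        (let V = (\<lambda>u. \<psi> u + of_int (ord_at Q (Poly_Mapping.lookup a u)) *\<^sub>R \<gamma>) ` Poly_Mapping.keys a
         in \<nu> (realize \<iota> \<xi> a) \<in> V \<and> (\<forall>g\<in>V. le (\<nu> (realize \<iota> \<xi> a)) g)))"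

text \<open>
  \<open>R\<close> is the family of the \<open>\<int>\<close>-graded pieces.  As the valuation \<open>v\<^sub>D\<close> is homogeneous, all its
  values are attained at elements of a single piece.
\<close>

definition value_cone :: "(int \<Rightarrow> 'f::zero set) \<Rightarrow> ('f \<Rightarrow> 'g::euclidean_space) \<Rightarrow> (real \<times> 'g) set" where
  "value_cone R \<nu> = closure (convex_cone hull {(of_int k, \<nu> s) | k s. s \<in> R k \<and> s \<noteq> 0})"

definition newton_okounkov_body ::
  "'f::field set set \<Rightarrow> ('f set \<Rightarrow> int) \<Rightarrow> ('f \<Rightarrow> 'g::euclidean_space) \<Rightarrow> 'g set" where
  "newton_okounkov_body X D \<nu> = snd ` (value_cone (section_ring X D) \<nu> \<inter> fst -` {1})"

end

theory Submission
  imports Defs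
begin

text \<open>
  The valuation is homogeneous, so its values on the section ring are those of the homogeneous sections
  \<open>f \<cdot> \<chi>\<^sup>u\<close> of degree \<open>(k, u)\<close>, namely \<open>\<psi> u + l \<cdot> \<gamma>\<close> where \<open>l\<close> is the order of \<open>f\<close> at \<open>P j\<close>.  On the
  projective line a divisor is principal if and only if its degree is zero.  Hence the orders \<open>l\<close> that occur for
  a given degree \<open>(k, u)\<close> are exactly the integers from \<open>- \<lfloor>\<Delta> j (k, u)\<rfloor>\<close> to \<open>\<Sum> \<lfloor>\<Delta> i (k, u)\<rfloor>\<close>, summed
  over \<open>i \<noteq> j\<close>: the lower bound is the pole condition at \<open>P j\<close>, the upper bound is the degree that
  remains for the other points (\<open>exists_section_of_order_iff\<close>, \<open>values_eq_degrees\<close>).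
  
  Dropping the rounding turns this set of lattice points \<open>((k, u), l)\<close> into a real cone \<open>C\<close>, whose slice at \<open>k = 1\<close>
  is the set in the theorem whose image is taken.  The functions \<open>\<Delta> i\<close> are minima of finitely many rational linear
  forms, so \<open>C\<close> is a rational polyhedral cone and is generated by finitely many rational vectors.
  A suitable multiple of each of these has only integral data; there rounding does nothing, so the multiple is one
  of the lattice points (\<open>section_cone_generators\<close>).  Thus the lattice points span \<open>C\<close> itself.
  
  The cone of values is the closure of the image of \<open>C\<close> under the linear map \<open>((k, u), l) \<mapsto> (k, \<psi> u + l \<cdot> \<gamma>)\<close>.  This image is
  finitely generated, hence already closed, and its slice at \<open>k = 1\<close> is the image of the slice of \<open>C\<close>.
  
  The polyhedral geometry consists of one form of the Weyl-Minkowski theorem, proved by double description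
  (\<open>finitely_generated_Int_halfspaces\<close>).  It is applied over \<open>\<rat>\<close> to the coefficients of the
  polyhedral divisor, which are sets of rational points, and over \<open>\<real>\<close> to \<open>C\<close>.
\<close>

section \<open>Divisors on the projective line\<close>

text \<open>
  The order does not depend on the fraction that represents the function, because orders and degrees of
  polynomials are additive under multiplication and two such fractions agree after cross-multiplying.
\<close>

lemma ord_at_Fract:
  fixes p q :: "'k::field poly"
  assumes "p \<noteq> 0" "q \<noteq> 0"
  shows "ord_at Q (Fraction_Field.Fract p q) =
    (case Q of Aff a \<Rightarrow> int (order a p) - int (order a q) | Infty \<Rightarrow> int (degree q) - int (degree p))"
  unfolding ord_at_def
proof (rule the_equality)
  fix n
  assume "\<exists>p' q'. p' \<noteq> 0 \<and> q' \<noteq> 0 \<and> Fraction_Field.Fract p q = Fraction_Field.Fract p' q' \<and>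
     n = (case Q of Aff a \<Rightarrow> int (order a p') - int (order a q')
                  | Infty \<Rightarrow> int (degree q') - int (degree p'))"
  then obtain p' q' where nz: "p' \<noteq> 0" "q' \<noteq> 0"
    and eq: "Fraction_Field.Fract p q = Fraction_Field.Fract p' q'"
    and n: "n = (case Q of Aff a \<Rightarrow> int (order a p') - int (order a q')
                  | Infty \<Rightarrow> int (degree q') - int (degree p'))" by blast
  have cross: "p * q' = p' * q"
    using eq assms nz by (simp add: eq_fract)
  have "order a p + order a q' = order a p' + order a q" for a
    using cross assms nz by (metis order_mult mult_eq_0_iff)
  moreover have "degree p + degree q' = degree p' + degree q"
    using cross assms nz by (metis degree_mult_eq)
  ultimately show "n = (case Q of Aff a \<Rightarrow> int (order a p) - int (order a q)
                  | Infty \<Rightarrow> int (degree q) - int (degree p))"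
    unfolding n by (cases Q) (auto simp: algebra_simps dest: arg_cong[of _ _ int], metis of_nat_add)
qed (use assms in blast)

lemma ord_at_mult:
  fixes f g :: "'k::field poly fract"
  assumes "f \<noteq> 0" "g \<noteq> 0"
  shows "ord_at Q (f * g) = ord_at Q f + ord_at Q g"
proof -
  obtain p q where f: "f = Fraction_Field.Fract p q" "q \<noteq> 0" "p \<noteq> 0"
    using assms by (metis Fract_cases fract_collapse(1))
  obtain p' q' where g: "g = Fraction_Field.Fract p' q'" "q' \<noteq> 0" "p' \<noteq> 0"
    using assms by (metis Fract_cases fract_collapse(1))
  show ?thesis
    using f g by (cases Q) (simp_all add: ord_at_Fract order_mult degree_mult_eq)
qed

lemma order_linear_factor: "order a [:- x, 1:] = (if a = (x::'k::field) then 1 else 0)"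
  using order_power_n_n[of x 1] by (auto intro!: order_0I)

text \<open>
  The point where algebraic closedness enters: a zero can be split off until the polynomial is constant.
\<close>

lemma sum_order_eq_degree:
  fixes p :: "'k::alg_closed_field poly"
  assumes "p \<noteq> 0" "finite A" "{a. poly p a = 0} \<subseteq> A"
  shows "(\<Sum>a\<in>A. order a p) = degree p"
  using assms
proof (induction "degree p" arbitrary: p rule: less_induct)
  case less
  show ?case
  proof (cases "degree p = 0")
    case True
    then have "poly p a \<noteq> 0" for a
      using less.prems(1) by (auto elim!: degree_eq_zeroE)
    then show ?thesis
      using True by (simp add: order_0I)
  next
    case False
    then obtain x where x: "poly p x = 0"
      using alg_closed_imp_poly_has_root by blast
    then obtain q where p: "p = [:- x, 1:] * q"
      by (metis dvdE poly_eq_0_iff_dvd)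
    have q: "q \<noteq> 0"
      using p less.prems(1) by auto
    then have deg: "degree p = Suc (degree q)"
      unfolding p by (subst degree_mult_eq) auto
    have "(\<Sum>a\<in>A. order a q) = degree q"
      by (rule less.hyps) (use deg q less.prems p in auto)
    moreover have "order a p = (if a = x then 1 else 0) + order a q" for a
      unfolding p order_mult[OF less.prems(1)[unfolded p]] order_linear_factor ..
    moreover have "x \<in> A"
      using x less.prems by auto
    ultimately show ?thesis
      using deg less.prems(2) by (simp add: sum.distrib)
  qed
qed

text \<open>
  Principal divisors have degree zero: the orders at the affine points add up to the difference
  of the degrees of numerator and denominator, which is minus the order at infinity.  The exceptional
  set \<open>T\<close> may be enlarged freely, so that the sum can be taken over a set that also contains
  prescribed points.
\<close>

lemma sum_ord_at_eq_0:
  fixes f :: "'k::alg_closed_field poly fract"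
  assumes "f \<noteq> 0"
  obtains T where "finite T"
    "\<And>T'. finite T' \<Longrightarrow> T \<subseteq> T' \<Longrightarrow> (\<Sum>Q\<in>T'. ord_at Q f) = 0"
proof -
  obtain p q where f: "f = Fraction_Field.Fract p q" "q \<noteq> 0" "p \<noteq> 0"
    using assms by (metis Fract_cases fract_collapse(1))
  define A where "A = {a. poly p a = 0} \<union> {a. poly q a = 0}"
  have A: "finite A"
    unfolding A_def using f poly_roots_finite by blast
  define T where "T = insert Infty (Aff ` A)"
  have out: "ord_at Q f = 0" if "Q \<notin> T" for Q
  proof (cases Q)
    case (Aff a)
    then have "poly p a \<noteq> 0" "poly q a \<noteq> 0"
      using that by (auto simp: T_def A_def)
    then show ?thesis
      using Aff f by (simp add: ord_at_Fract order_0I)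
  qed (use that in \<open>simp add: T_def\<close>)
  have T: "finite T"
    using A by (simp add: T_def)
  have "(\<Sum>Q\<in>Aff ` A. ord_at Q f) = (\<Sum>a\<in>A. int (order a p) - int (order a q))"
    using f by (subst sum.reindex) (auto simp: inj_on_def ord_at_Fract)
  also have "\<dots> = int (\<Sum>a\<in>A. order a p) - int (\<Sum>a\<in>A. order a q)"
    by (simp add: sum_subtractf)
  also have "\<dots> = int (degree p) - int (degree q)"
    using f A by (simp add: sum_order_eq_degree A_def)
  finally have "(\<Sum>Q\<in>T. ord_at Q f) = 0"
    using A f unfolding T_def by (subst sum.insert) (auto simp: ord_at_Fract)
  then have "(\<Sum>Q\<in>T'. ord_at Q f) = 0" if "finite T'" "T \<subseteq> T'" for T'
    using sum.mono_neutral_left[OF that, of "\<lambda>Q. ord_at Q f"] out by auto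
  then show thesis
    using that T by blast
qed

lemma exists_affine_orders:
  fixes n :: "'k::field \<Rightarrow> int"
  assumes "finite A"
  shows "\<exists>f::'k poly fract. f \<noteq> 0 \<and> (\<forall>a. ord_at (Aff a) f = (if a \<in> A then n a else 0))"
  using assms
proof (induction rule: finite_induct)
  case empty
  have "ord_at (Aff a) 1 = 0" for a :: 'k
    unfolding One_fract_def by (subst ord_at_Fract) auto
  then show ?case
    by (intro exI[of _ 1]) simp
next
  case (insert x A)
  then obtain f :: "'k poly fract" where f: "f \<noteq> 0"
      "\<And>a. ord_at (Aff a) f = (if a \<in> A then n a else 0)"
    by blast
  define p q where "p = [:- x, 1:] ^ nat (n x)" and "q = [:- x, 1:] ^ nat (- n x)"
  have nz: "p \<noteq> 0" "q \<noteq> 0"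
    by (simp_all add: p_def q_def)
  have ord: "order a ([:- x, 1:] ^ k) = (if a = x then k else 0)" for a k
    by (auto simp: order_power_n_n intro!: order_0I)
  define g where "g = Fraction_Field.Fract p q"
  have "g \<noteq> 0"
    unfolding g_def Zero_fract_def using nz by (subst eq_fract) auto
  moreover have "ord_at (Aff a) g = (if a = x then n x else 0)" for a
    unfolding g_def ord_at_Fract[OF nz] by (simp add: p_def q_def ord)
  ultimately have g: "g \<noteq> 0" "\<And>a. ord_at (Aff a) g = (if a = x then n x else 0)"
    by auto
  show ?case
    using f g insert.hyps by (intro exI[of _ "f * g"]) (auto simp: ord_at_mult)
qed


text \<open>
  Conversely, on the projective line every divisor of degree zero is principal.  A product of powers
  of linear factors has the prescribed orders at the affine points; the order at infinity is then
  correct because both divisors have degree zero.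
\<close>

lemma exists_principal_divisor:
  fixes n :: "'k::alg_closed_field proj_line \<Rightarrow> int"
  assumes "finite T" "\<And>Q. Q \<notin> T \<Longrightarrow> n Q = 0" "(\<Sum>Q\<in>T. n Q) = 0"
  shows "\<exists>f::'k poly fract. f \<noteq> 0 \<and> (\<forall>Q. ord_at Q f = n Q)"
proof -
  define A where "A = Aff -` T"
  have A: "finite A"
    unfolding A_def using assms(1) by (intro finite_vimageI) (auto simp: inj_on_def)
  obtain f :: "'k poly fract" where f: "f \<noteq> 0"
      "\<And>a. ord_at (Aff a) f = (if a \<in> A then n (Aff a) else 0)"
    using exists_affine_orders[OF A, of "\<lambda>a. n (Aff a)"] by blast
  have aff: "ord_at (Aff a) f = n (Aff a)" for a
    using assms(2) f by (auto simp: A_def)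
  obtain T' where T': "finite T'" "\<And>S. finite S \<Longrightarrow> T' \<subseteq> S \<Longrightarrow> (\<Sum>Q\<in>S. ord_at Q f) = 0"
    using sum_ord_at_eq_0[OF f(1)] by metis
  define S where "S = T \<union> T' - {Infty}"
  have S: "finite S" "Infty \<notin> S"
    using assms T' by (auto simp: S_def)
  have "(\<Sum>Q\<in>insert Infty S. ord_at Q f) = 0"
    by (rule T') (use S in \<open>auto simp: S_def\<close>)
  moreover have "(\<Sum>Q\<in>insert Infty S. n Q) = (\<Sum>Q\<in>T. n Q)"
    by (rule sum.mono_neutral_right) (use assms S in \<open>auto simp: S_def\<close>)
  moreover have "(\<Sum>Q\<in>S. ord_at Q f) = (\<Sum>Q\<in>S. n Q)"
  proof (rule sum.cong)
    fix Q assume "Q \<in> S"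
    then show "ord_at Q f = n Q" using aff S(2) by (cases Q) auto
  qed simp
  ultimately have "ord_at Infty f = n Infty"
    using S assms(3) by simp
  then have "ord_at Q f = n Q" for Q
    using aff by (cases Q) auto
  then show ?thesis
    using f(1) by blast
qed

text \<open>
  The vanishing orders at \<open>P j\<close> of the sections of the divisor \<open>\<Sum> e i \<cdot> P i\<close>.  The lower bound is the
  pole condition at \<open>P j\<close>.  The upper bound is the degree of the rest of the divisor, as all orders add
  up to zero and those away from \<open>P j\<close> are bounded below.  Every order in between occurs, because
  a divisor of degree zero that satisfies the pole conditions is the divisor of a section.
\<close>

lemma exists_section_of_order_iff:
  fixes P :: "nat \<Rightarrow> 'k::alg_closed_field proj_line" and l :: int
  assumes inj: "inj_on P {..m}" and j: "j \<le> m"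
    and e: "\<And>i. i \<le> m \<Longrightarrow> (\<exists>z. e i = ereal (of_int z)) \<or> e i = \<infinity>"
  shows "(\<exists>f\<in>H0_P1 (\<lambda>Q. \<Sum>i | i \<le> m \<and> P i = Q. e i). f \<noteq> 0 \<and> ord_at (P j) f = l) \<longleftrightarrow>
    - e j \<le> ereal (of_int l) \<and> ereal (of_int l) \<le> (\<Sum>i\<in>{..m} - {j}. e i)"
proof -
  define I where "I = {..m} - {j}"
  have I: "finite I" "I \<subseteq> {..m}" "{..m} = insert j I" "j \<notin> I"
    using j by (auto simp: I_def)
  have "\<forall>i\<in>{..m}. \<exists>z. e i = ereal (of_int z) \<or> e i = \<infinity>"
    using e by auto
  from bchoice[OF this] obtain z :: "nat \<Rightarrow> int"
    where z: "\<And>i. i \<le> m \<Longrightarrow> e i = ereal (of_int (z i)) \<or> e i = \<infinity>"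
    by auto
  have at_P: "(\<Sum>i' | i' \<le> m \<and> P i' = P i. e i') = e i" if "i \<le> m" for i
  proof -
    have "{i'. i' \<le> m \<and> P i' = P i} = {i}"
      using that inj by (auto simp: inj_on_def)
    then show ?thesis by simp
  qed
  have off_P: "(\<Sum>i | i \<le> m \<and> P i = Q. e i) = 0" if "Q \<notin> P ` {..m}" for Q
    using that by (intro sum.neutral) auto
  have H0: "f \<in> H0_P1 (\<lambda>Q. \<Sum>i | i \<le> m \<and> P i = Q. e i) \<longleftrightarrow>
      (\<forall>i\<le>m. 0 \<le> ereal (of_int (ord_at (P i) f)) + e i) \<and> (\<forall>Q. Q \<notin> P ` {..m} \<longrightarrow> 0 \<le> ord_at Q f)"
    if "f \<noteq> 0" for f
  proof
    assume "f \<in> H0_P1 (\<lambda>Q. \<Sum>i | i \<le> m \<and> P i = Q. e i)"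
    then have *: "0 \<le> ereal (of_int (ord_at Q f)) + (\<Sum>i | i \<le> m \<and> P i = Q. e i)" for Q
      using that by (simp add: H0_P1_def)
    have "0 \<le> ereal (of_int (ord_at (P i) f)) + e i" if "i \<le> m" for i
      using *[of "P i"] unfolding at_P[OF that] .
    moreover have "0 \<le> ord_at Q f" if "Q \<notin> P ` {..m}" for Q
      using *[of Q] unfolding off_P[OF that] by simp
    ultimately show "(\<forall>i\<le>m. 0 \<le> ereal (of_int (ord_at (P i) f)) + e i) \<and>
        (\<forall>Q. Q \<notin> P ` {..m} \<longrightarrow> 0 \<le> ord_at Q f)" by blast
  next
    assume *: "(\<forall>i\<le>m. 0 \<le> ereal (of_int (ord_at (P i) f)) + e i) \<and>
        (\<forall>Q. Q \<notin> P ` {..m} \<longrightarrow> 0 \<le> ord_at Q f)"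
    have "0 \<le> ereal (of_int (ord_at Q f)) + (\<Sum>i | i \<le> m \<and> P i = Q. e i)" for Q
    proof (cases "Q \<in> P ` {..m}")
      case True
      then obtain i where "i \<le> m" "Q = P i" by auto
      then show ?thesis using * by (simp add: at_P)
    next
      case False
      then show ?thesis using * by (simp add: off_P)
    qed
    then show "f \<in> H0_P1 (\<lambda>Q. \<Sum>i | i \<le> m \<and> P i = Q. e i)"
      by (simp add: H0_P1_def)
  qed
  show ?thesis
    unfolding I_def[symmetric]
  proof
    assume "\<exists>f\<in>H0_P1 (\<lambda>Q. \<Sum>i | i \<le> m \<and> P i = Q. e i). f \<noteq> 0 \<and> ord_at (P j) f = l"
    then obtain f where "f \<in> H0_P1 (\<lambda>Q. \<Sum>i | i \<le> m \<and> P i = Q. e i)"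
      and "f \<noteq> 0" and l: "ord_at (P j) f = l"
      by blast
    then have at: "\<And>i. i \<le> m \<Longrightarrow> 0 \<le> ereal (of_int (ord_at (P i) f)) + e i"
      and off: "\<And>Q. Q \<notin> P ` {..m} \<Longrightarrow> 0 \<le> ord_at Q f"
      using H0[OF \<open>f \<noteq> 0\<close>] by simp_all
    have "- e j \<le> ereal (of_int l)"
      using at[OF j] l z[OF j] by auto
    moreover have "ereal (of_int l) \<le> (\<Sum>i\<in>I. e i)"
    proof (cases "\<exists>i\<in>I. e i = \<infinity>")
      case True
      then have "(\<Sum>i\<in>I. e i) = \<infinity>"
        using I(1) by (simp add: sum_Pinfty)
      then show ?thesis by simp
    next
      case False
      then have zI: "e i = ereal (of_int (z i))" if "i \<in> I" for i
        using that z I(2) by auto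
      obtain T where T: "finite T" "\<And>T'. finite T' \<Longrightarrow> T \<subseteq> T' \<Longrightarrow> (\<Sum>Q\<in>T'. ord_at Q f) = 0"
        using sum_ord_at_eq_0[OF \<open>f \<noteq> 0\<close>] by metis
      define S where "S = T \<union> P ` {..m}"
      have S: "finite S" "P ` I \<subseteq> S - {P j}"
        using T inj I by (auto simp: S_def inj_on_def)
      have "(\<Sum>i\<in>I. - z i) \<le> (\<Sum>i\<in>I. ord_at (P i) f)"
      proof (rule sum_mono)
        fix i assume "i \<in> I"
        then show "- z i \<le> ord_at (P i) f"
          using at[of i] zI[of i] I(2) by auto
      qed
      also have "\<dots> = (\<Sum>Q\<in>P ` I. ord_at Q f)"
        using inj I(2) by (subst sum.reindex) (auto intro: inj_on_subset)
      also have "\<dots> \<le> (\<Sum>Q\<in>S - {P j}. ord_at Q f)"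
        by (rule sum_mono2) (use S off I in auto)
      also have "\<dots> = (\<Sum>Q\<in>S. ord_at Q f) - l"
        using S j l by (subst sum_diff1) (auto simp: S_def)
      also have "(\<Sum>Q\<in>S. ord_at Q f) = 0"
        using T S by (auto simp: S_def)
      finally have "l \<le> (\<Sum>i\<in>I. z i)"
        by (simp add: sum_negf)
      then have "real_of_int l \<le> (\<Sum>i\<in>I. real_of_int (z i))"
        by (metis of_int_le_iff of_int_sum)
      then show ?thesis
        by (simp add: zI)
    qed
    ultimately show "- e j \<le> ereal (of_int l) \<and> ereal (of_int l) \<le> (\<Sum>i\<in>I. e i)" ..
  next
    assume bnd: "- e j \<le> ereal (of_int l) \<and> ereal (of_int l) \<le> (\<Sum>i\<in>I. e i)"
    \<comment> \<open>Admissible orders at the other points, with total at most \<open>- l\<close>. A single infinite coefficient can absorb everything.\<close>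
    have "\<exists>n. (\<forall>i\<in>I. - e i \<le> ereal (of_int (n i))) \<and> (\<Sum>i\<in>I. n i) \<le> - l"
    proof (cases "\<exists>i\<in>I. e i = \<infinity>")
      case True
      then obtain i0 where i0: "i0 \<in> I" "e i0 = \<infinity>" by blast
      define n where "n = (\<lambda>i. if i = i0 then - l - (\<Sum>i\<in>I - {i0}. - z i) else - z i)"
      have "(\<Sum>i\<in>I. n i) = - l"
        using i0 I(1) by (subst sum.remove[of _ i0]) (auto simp: n_def)
      moreover have "- e i \<le> ereal (of_int (n i))" if "i \<in> I" for i
      proof -
        have "i \<le> m" using that I(2) by auto
        from z[OF this] show ?thesis using i0 by (auto simp: n_def)
      qed
      ultimately show ?thesis by (intro exI[of _ n]) auto
    next
      case False
      then have zI: "e i = ereal (of_int (z i))" if "i \<in> I" for i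
        using that z I(2) by auto
      then have "real_of_int l \<le> (\<Sum>i\<in>I. real_of_int (z i))"
        using bnd by (simp add: zI)
      then have "l \<le> (\<Sum>i\<in>I. z i)"
        by (metis of_int_le_iff of_int_sum)
      then show ?thesis
        using zI by (intro exI[of _ "\<lambda>i. - z i"]) (auto simp: sum_negf)
    qed
    then obtain n where n: "\<And>i. i \<in> I \<Longrightarrow> - e i \<le> ereal (of_int (n i))" "(\<Sum>i\<in>I. n i) \<le> - l"
      by blast
    \<comment> \<open>The missing degree, to be spent on extra zeros at some point \<open>Q0\<close> other than \<open>P j\<close>.\<close>
    define s where "s = - l - (\<Sum>i\<in>I. n i)"
    obtain Q0 where Q0: "Q0 \<noteq> P j"
      by (metis proj_line.distinct(1))
    define N where "N = (\<lambda>Q. (\<Sum>i | i \<in> insert j I \<and> P i = Q. if i = j then l else n i) + (if Q = Q0 then s else 0))"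
    define T where "T = insert Q0 (P ` {..m})"
    have T: "finite T" by (simp add: T_def)
    have "(\<Sum>Q\<in>T. N Q) = (\<Sum>i\<in>insert j I. if i = j then l else n i) + s"
    proof -
      have "(\<Sum>Q\<in>T. \<Sum>i | i \<in> insert j I \<and> P i = Q. if i = j then l else n i) =
          (\<Sum>i\<in>insert j I. if i = j then l else n i)"
        by (rule sum.group) (use T I in \<open>auto simp: T_def\<close>)
      then show ?thesis
        using T by (simp add: N_def sum.distrib T_def)
    qed
    also have "(\<Sum>i\<in>insert j I. if i = j then l else n i) = l + (\<Sum>i\<in>I. n i)"
      using I by (auto intro!: sum.cong)
    finally have sum0: "(\<Sum>Q\<in>T. N Q) = 0"
      by (simp add: s_def)
    have "N Q = 0" if "Q \<notin> T" for Q
      using that I by (auto simp: N_def T_def intro!: sum.neutral)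
    then obtain f :: "'k poly fract" where f: "f \<noteq> 0" "\<And>Q. ord_at Q f = N Q"
      using exists_principal_divisor[OF T _ sum0] by blast
    have s: "0 \<le> s"
      using n(2) by (simp add: s_def)
    have N_P: "N (P i) = (if i = j then l else n i) + (if P i = Q0 then s else 0)" if "i \<le> m" for i
    proof -
      have "{i'. i' \<in> insert j I \<and> P i' = P i} = {i}"
        using that inj I(3)[symmetric] by (auto simp: inj_on_def)
      then show ?thesis unfolding N_def by (simp only: sum.insert sum.empty) simp
    qed
    have "0 \<le> ereal (of_int (N (P i))) + e i" if "i \<le> m" for i
    proof (cases "i = j")
      case True
      then show ?thesis
        using bnd N_P[OF that] Q0 z[OF j] by auto
    next
      case False
      then have "i \<in> I" using that by (simp add: I_def)
      then show ?thesis
        using n(1)[of i] False N_P[OF that] s z[OF that] by auto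
    qed
    moreover have "0 \<le> N Q" if "Q \<notin> P ` {..m}" for Q
    proof -
      have "(\<Sum>i | i \<in> insert j I \<and> P i = Q. if i = j then l else n i) = 0"
        using that I by (intro sum.neutral) auto
      then show ?thesis using s by (simp add: N_def)
    qed
    ultimately have "f \<in> H0_P1 (\<lambda>Q. \<Sum>i | i \<le> m \<and> P i = Q. e i)"
      using H0[OF f(1)] f(2) by auto
    moreover have "ord_at (P j) f = l"
      using f N_P[OF j] Q0 by auto
    ultimately show "\<exists>f\<in>H0_P1 (\<lambda>Q. \<Sum>i | i \<le> m \<and> P i = Q. e i). f \<noteq> 0 \<and> ord_at (P j) f = l"
      using f(1) by blast
  qed
qed

section \<open>Cones over subfields of the reals\<close>

text \<open>
  The coefficients of a polyhedral divisor are sets of rational points, whereas weights and cones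
  of values are real.  Both settings are treated at once by cones with coefficients in a subfield of the reals.
\<close>

definition real_subfield :: "real set \<Rightarrow> bool" where
  "real_subfield F \<longleftrightarrow> \<rat> \<subseteq> F \<and> (\<forall>x\<in>F. \<forall>y\<in>F. x + y \<in> F \<and> x * y \<in> F \<and> x / y \<in> F)"

lemma real_subfield_Rats: "real_subfield \<rat>" and real_subfield_UNIV: "real_subfield UNIV"
  by (auto simp: real_subfield_def)

definition cone_over :: "real set \<Rightarrow> 'a::real_vector set \<Rightarrow> 'a set" where
  "cone_over F V = {\<Sum>v\<in>V. c v *\<^sub>R v | c. \<forall>v\<in>V. c v \<in> F \<and> 0 \<le> c v}"

context
  fixes F :: "real set"
  assumes F: "real_subfield F"
begin

lemma subfield_closed:
  "x \<in> \<rat> \<Longrightarrow> x \<in> F" "0 \<in> F" "1 \<in> F"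
  "x \<in> F \<Longrightarrow> y \<in> F \<Longrightarrow> x + y \<in> F" "x \<in> F \<Longrightarrow> y \<in> F \<Longrightarrow> x * y \<in> F" "x \<in> F \<Longrightarrow> y \<in> F \<Longrightarrow> x / y \<in> F"
  "x \<in> F \<Longrightarrow> - x \<in> F"
proof -
  show neg: "- x \<in> F" if "x \<in> F" for x
  proof -
    have "- 1 * x \<in> F" using F that unfolding real_subfield_def
      by (metis Rats_1 Rats_minus_iff subsetD)
    then show ?thesis by simp
  qed
qed (use F in \<open>auto simp: real_subfield_def\<close>)

lemma subfield_sum: "(\<And>i. i \<in> I \<Longrightarrow> f i \<in> F) \<Longrightarrow> (\<Sum>i\<in>I. f i) \<in> F"
  by (induction I rule: infinite_finite_induct) (auto simp: subfield_closed)

lemma cone_over_0: "0 \<in> cone_over F V"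
  unfolding cone_over_def using subfield_closed(2) by (auto intro!: exI[of _ "\<lambda>_. 0"])

lemma cone_over_add: "x \<in> cone_over F V \<Longrightarrow> y \<in> cone_over F V \<Longrightarrow> x + y \<in> cone_over F V"
proof -
  assume "x \<in> cone_over F V" "y \<in> cone_over F V"
  then obtain c d where "\<forall>v\<in>V. c v \<in> F \<and> 0 \<le> c v" "\<forall>v\<in>V. d v \<in> F \<and> 0 \<le> d v"
    and xy: "x = (\<Sum>v\<in>V. c v *\<^sub>R v)" "y = (\<Sum>v\<in>V. d v *\<^sub>R v)"
    unfolding cone_over_def by blast
  then have "\<forall>v\<in>V. c v + d v \<in> F \<and> 0 \<le> c v + d v"
    using subfield_closed by auto
  moreover have "x + y = (\<Sum>v\<in>V. (c v + d v) *\<^sub>R v)"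
    unfolding xy by (simp add: sum.distrib scaleR_add_left)
  ultimately show ?thesis
    unfolding cone_over_def mem_Collect_eq by (intro exI[of _ "\<lambda>v. c v + d v"]) simp
qed

lemma cone_over_scale: "x \<in> cone_over F V \<Longrightarrow> a \<in> F \<Longrightarrow> 0 \<le> a \<Longrightarrow> a *\<^sub>R x \<in> cone_over F V"
proof -
  assume "x \<in> cone_over F V" and a: "a \<in> F" "0 \<le> a"
  then obtain c where "\<forall>v\<in>V. c v \<in> F \<and> 0 \<le> c v" and x: "x = (\<Sum>v\<in>V. c v *\<^sub>R v)"
    unfolding cone_over_def by blast
  then have "\<forall>v\<in>V. a * c v \<in> F \<and> 0 \<le> a * c v"
    using subfield_closed a by auto
  moreover have "a *\<^sub>R x = (\<Sum>v\<in>V. (a * c v) *\<^sub>R v)"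
    unfolding x by (simp add: scaleR_sum_right)
  ultimately show ?thesis
    unfolding cone_over_def mem_Collect_eq by (intro exI[of _ "\<lambda>v. a * c v"]) simp
qed

lemma cone_over_sum:
  "(\<And>i. i \<in> I \<Longrightarrow> f i \<in> cone_over F V) \<Longrightarrow> (\<Sum>i\<in>I. f i) \<in> cone_over F V"
  by (induction I rule: infinite_finite_induct) (auto simp: cone_over_0 cone_over_add)

lemma cone_over_base: "finite V \<Longrightarrow> v \<in> V \<Longrightarrow> v \<in> cone_over F V"
proof -
  assume V: "finite V" "v \<in> V"
  have "v = (\<Sum>w\<in>V. (if w = v then 1 else 0) *\<^sub>R w)"
    using V by (simp add: if_distrib [of "\<lambda>c. c *\<^sub>R _"] if_distribR cong: if_cong)
  then show ?thesis
    unfolding cone_over_def mem_Collect_eq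
    by (intro exI[of _ "\<lambda>w. if w = v then 1 else 0"]) (use subfield_closed in auto)
qed

lemma cone_over_least:
  assumes "V \<subseteq> K" "0 \<in> K" "\<And>x y. x \<in> K \<Longrightarrow> y \<in> K \<Longrightarrow> x + y \<in> K"
    "\<And>a x. a \<in> F \<Longrightarrow> 0 \<le> a \<Longrightarrow> x \<in> K \<Longrightarrow> a *\<^sub>R x \<in> K"
  shows "cone_over F V \<subseteq> K"
proof
  fix x assume "x \<in> cone_over F V"
  then obtain c where c: "\<forall>v\<in>V. c v \<in> F \<and> 0 \<le> c v" and x: "x = (\<Sum>v\<in>V. c v *\<^sub>R v)"
    unfolding cone_over_def by blast
  have "(\<Sum>v\<in>W. c v *\<^sub>R v) \<in> K" if "W \<subseteq> V" for W
    using that by (induction W rule: infinite_finite_induct) (use assms c in auto)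
  then show "x \<in> K" unfolding x by blast
qed

lemma cone_over_Times:
  assumes "finite V" "finite W"
  shows "cone_over F ((\<lambda>v. (v, 0)) ` V \<union> Pair 0 ` W) = cone_over F V \<times> cone_over F W"
    (is "cone_over F ?U = _")
proof
  show "cone_over F ?U \<subseteq> cone_over F V \<times> cone_over F W"
    by (rule cone_over_least)
      (use assms in \<open>auto simp: zero_prod_def intro: cone_over_0 cone_over_add cone_over_scale cone_over_base\<close>)
  have U: "finite ?U" using assms by simp
  have left: "cone_over F V \<subseteq> {v. (v, 0) \<in> cone_over F ?U}"
  proof (rule cone_over_least)
    show "V \<subseteq> {v. (v, 0) \<in> cone_over F ?U}"
      using cone_over_base[OF U] by auto
    show "0 \<in> {v. (v, 0) \<in> cone_over F ?U}"
      using cone_over_0[of ?U] by (simp add: zero_prod_def)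
    show "x + y \<in> {v. (v, 0) \<in> cone_over F ?U}"
      if "x \<in> {v. (v, 0) \<in> cone_over F ?U}" "y \<in> {v. (v, 0) \<in> cone_over F ?U}" for x y
      using cone_over_add[of "(x, 0)" ?U "(y, 0)"] that by simp
    show "a *\<^sub>R x \<in> {v. (v, 0) \<in> cone_over F ?U}"
      if "a \<in> F" "0 \<le> a" "x \<in> {v. (v, 0) \<in> cone_over F ?U}" for a x
      using cone_over_scale[of "(x, 0)" ?U a] that by simp
  qed
  have right: "cone_over F W \<subseteq> {w. (0, w) \<in> cone_over F ?U}"
  proof (rule cone_over_least)
    show "W \<subseteq> {w. (0, w) \<in> cone_over F ?U}"
      using cone_over_base[OF U] by auto
    show "0 \<in> {w. (0, w) \<in> cone_over F ?U}"
      using cone_over_0[of ?U] by (simp add: zero_prod_def)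
    show "x + y \<in> {w. (0, w) \<in> cone_over F ?U}"
      if "x \<in> {w. (0, w) \<in> cone_over F ?U}" "y \<in> {w. (0, w) \<in> cone_over F ?U}" for x y
      using cone_over_add[of "(0, x)" ?U "(0, y)"] that by simp
    show "a *\<^sub>R x \<in> {w. (0, w) \<in> cone_over F ?U}"
      if "a \<in> F" "0 \<le> a" "x \<in> {w. (0, w) \<in> cone_over F ?U}" for a x
      using cone_over_scale[of "(0, x)" ?U a] that by simp
  qed
  show "cone_over F V \<times> cone_over F W \<subseteq> cone_over F ?U"
  proof (clarify)
    fix x y assume "x \<in> cone_over F V" "y \<in> cone_over F W"
    then have "(x, 0) + (0, y) \<in> cone_over F ?U"
      using left right by (intro cone_over_add) auto
    then show "(x, y) \<in> cone_over F ?U" by simp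
  qed
qed

lemma cone_over_1_minus_1: "cone_over F {1, - 1} = F"
proof
  show "cone_over F {1, - 1} \<subseteq> F"
    by (rule cone_over_least) (use subfield_closed in \<open>auto\<close>)
  show "F \<subseteq> cone_over F {1, - 1}"
  proof
    fix x assume x: "x \<in> F"
    have "\<bar>x\<bar> *\<^sub>R (if 0 \<le> x then 1 else - 1) \<in> cone_over F {1, - 1 :: real}"
      using x subfield_closed(7)[OF x] by (intro cone_over_scale cone_over_base) (auto simp: abs_if)
    then show "x \<in> cone_over F {1, - 1}" by (auto split: if_splits)
  qed
qed

lemma cone_over_symmetric:
  assumes "finite I" "\<And>i. i \<in> I \<Longrightarrow> c i \<in> F"
  shows "(\<Sum>i\<in>I. c i *\<^sub>R f i) \<in> cone_over F (f ` I \<union> uminus ` f ` I)"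
proof (rule cone_over_sum)
  fix i assume i: "i \<in> I"
  have "\<bar>c i\<bar> *\<^sub>R (if 0 \<le> c i then f i else - f i) \<in> cone_over F (f ` I \<union> uminus ` f ` I)"
    using i assms subfield_closed(7)[of "c i"]
    by (intro cone_over_scale cone_over_base) (auto simp: abs_if)
  then show "c i *\<^sub>R f i \<in> cone_over F (f ` I \<union> uminus ` f ` I)" by (auto split: if_splits)
qed

text \<open>
  The step of the double description method.  Apart from the generators on the correct side, it suffices
  to take the points at which the segments joining opposite sides cross the hyperplane.
\<close>

lemma cone_over_Int_halfspace:
  fixes V :: "'a::real_inner set"
  assumes V: "finite V" and h: "\<And>v. v \<in> V \<Longrightarrow> h \<bullet> v \<in> F"
  shows "{x \<in> cone_over F V. 0 \<le> h \<bullet> x} =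
    cone_over F ({v \<in> V. 0 \<le> h \<bullet> v} \<union>
      (\<lambda>(v, w). (h \<bullet> v) *\<^sub>R w - (h \<bullet> w) *\<^sub>R v) ` ({v \<in> V. 0 < h \<bullet> v} \<times> {v \<in> V. h \<bullet> v < 0}))"
    (is "?L = cone_over F ?W")
proof
  define p n where "p = {v \<in> V. 0 < h \<bullet> v}" and "n = {v \<in> V. h \<bullet> v < 0}"
  have fin: "finite ?W" "finite p" "finite n"
    using V by (auto simp: p_def n_def)
  have "?W \<subseteq> ?L"
  proof
    fix x assume "x \<in> ?W"
    then consider "x \<in> V" "0 \<le> h \<bullet> x" |
      v w where "v \<in> p" "w \<in> n" "x = (h \<bullet> v) *\<^sub>R w - (h \<bullet> w) *\<^sub>R v"
      by (auto simp: p_def n_def)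
    then show "x \<in> ?L"
    proof cases
      case 1
      then show ?thesis using cone_over_base V by auto
    next
      case 2
      have "(h \<bullet> v) *\<^sub>R w + (- (h \<bullet> w)) *\<^sub>R v \<in> cone_over F V"
        using 2 V h subfield_closed(7)
        by (intro cone_over_add cone_over_scale cone_over_base) (auto simp: p_def n_def)
      then show ?thesis using 2 by (simp add: inner_diff_right)
    qed
  qed
  then show "cone_over F ?W \<subseteq> ?L"
    by (rule cone_over_least)
      (auto intro: cone_over_0 cone_over_add cone_over_scale simp: inner_add_right)
  show "?L \<subseteq> cone_over F ?W"
  proof
    fix x assume "x \<in> ?L"
    then obtain c where c: "\<And>v. v \<in> V \<Longrightarrow> c v \<in> F \<and> 0 \<le> c v" and x: "x = (\<Sum>v\<in>V. c v *\<^sub>R v)"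
      and hx: "0 \<le> h \<bullet> x"
      unfolding cone_over_def by blast
    define z where "z = {v \<in> V. h \<bullet> v = 0}"
    have split: "(\<Sum>v\<in>V. f v) = (\<Sum>v\<in>z. f v) + (\<Sum>v\<in>p. f v) + (\<Sum>v\<in>n. f v)"
      for f :: "'a \<Rightarrow> 'b::comm_monoid_add"
    proof -
      have "V = z \<union> p \<union> n" by (auto simp: z_def p_def n_def)
      then have "(\<Sum>v\<in>V. f v) = (\<Sum>v\<in>z \<union> p \<union> n. f v)" by simp
      also have "\<dots> = (\<Sum>v\<in>z. f v) + (\<Sum>v\<in>p. f v) + (\<Sum>v\<in>n. f v)"
        using V by (subst sum.union_disjoint; (subst sum.union_disjoint)?)
          (auto simp: z_def p_def n_def)
      finally show ?thesis .
    qed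
    have sub: "z \<subseteq> V" "p \<subseteq> V" "n \<subseteq> V" by (auto simp: z_def p_def n_def)
    \<comment> \<open>The contributions of the two open sides to \<open>h \<bullet> x\<close>, which is their difference.\<close>
    define \<alpha> \<beta> where "\<alpha> = (\<Sum>v\<in>p. c v * (h \<bullet> v))" and "\<beta> = (\<Sum>v\<in>n. c v * (- (h \<bullet> v)))"
    have \<beta>0: "0 \<le> \<beta>"
      unfolding \<beta>_def using c sub by (intro sum_nonneg mult_nonneg_nonneg) (auto simp: n_def)
    have "h \<bullet> x = (\<Sum>v\<in>V. c v * (h \<bullet> v))"
      by (simp add: x inner_sum_right)
    also have "\<dots> = \<alpha> - \<beta>"
      by (subst split) (simp add: \<alpha>_def \<beta>_def z_def sum_negf)
    finally have \<alpha>\<beta>: "\<beta> \<le> \<alpha>" using hx by simp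
    have base: "v \<in> cone_over F ?W" if "v \<in> z \<union> p" for v
      using that by (intro cone_over_base fin) (auto simp: z_def p_def)
    have xz: "(\<Sum>v\<in>z. c v *\<^sub>R v) \<in> cone_over F ?W"
      using c sub base by (intro cone_over_sum cone_over_scale) auto
    show "x \<in> cone_over F ?W"
    proof (cases "\<beta> = 0")
      case True
      have "c v * (- (h \<bullet> v)) = 0" if "v \<in> n" for v
      proof -
        have "(\<Sum>v\<in>n. c v * (- (h \<bullet> v))) = 0 \<longleftrightarrow> (\<forall>v\<in>n. c v * (- (h \<bullet> v)) = 0)"
          using fin c sub
          by (intro sum_nonneg_eq_0_iff mult_nonneg_nonneg) (auto simp: n_def)
        then show ?thesis using True that unfolding \<beta>_def by blast
      qed
      then have "c v = 0" if "v \<in> n" for v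
        using that by (force simp: n_def)
      then have "x = (\<Sum>v\<in>z. c v *\<^sub>R v) + (\<Sum>v\<in>p. c v *\<^sub>R v)"
        unfolding x by (subst split) simp
      moreover have "(\<Sum>v\<in>p. c v *\<^sub>R v) \<in> cone_over F ?W"
        using c sub base by (intro cone_over_sum cone_over_scale) auto
      ultimately show ?thesis using xz cone_over_add by simp
    next
      case False
      then have \<alpha>0: "0 < \<alpha>" using \<beta>0 \<alpha>\<beta> by simp
      have \<alpha>F: "\<alpha> \<in> F"
        unfolding \<alpha>_def by (intro subfield_sum subfield_closed(5)) (use c h sub in auto)
      have \<beta>F: "\<beta> \<in> F"
        unfolding \<beta>_def by (intro subfield_sum subfield_closed(5,7)) (use c h sub in auto)
      have ratio: "1 + - (\<beta> / \<alpha>) \<in> F" "0 \<le> 1 + - (\<beta> / \<alpha>)"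
        using \<alpha>0 \<alpha>\<beta> subfield_closed(4)[OF subfield_closed(3) subfield_closed(7)[OF subfield_closed(6)[OF \<beta>F \<alpha>F]]]
        by auto
      \<comment> \<open>The negative part of \<open>x\<close>, balanced by the fraction \<open>\<beta> / \<alpha>\<close> of its positive part, lies in the hyperplane and is a combination of crossing points.\<close>
      define y where
        "y = (\<Sum>v\<in>p. \<Sum>w\<in>n. (c v * c w / \<alpha>) *\<^sub>R ((h \<bullet> v) *\<^sub>R w - (h \<bullet> w) *\<^sub>R v))"
      have y: "y \<in> cone_over F ?W"
        unfolding y_def
      proof (intro cone_over_sum cone_over_scale cone_over_base fin)
        fix v w assume vw: "v \<in> p" "w \<in> n"
        show "(h \<bullet> v) *\<^sub>R w - (h \<bullet> w) *\<^sub>R v \<in> ?W"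
          using vw by (auto simp: p_def n_def)
        show "c v * c w / \<alpha> \<in> F" "0 \<le> c v * c w / \<alpha>"
          using vw c sub \<alpha>F \<alpha>0 subfield_closed by (auto simp: subset_iff)
      qed
      have "y = (\<Sum>v\<in>p. \<Sum>w\<in>n. ((c v * (h \<bullet> v)) * (c w / \<alpha>)) *\<^sub>R w)
          + (\<Sum>v\<in>p. \<Sum>w\<in>n. ((c w * (- (h \<bullet> w))) * (c v / \<alpha>)) *\<^sub>R v)"
        unfolding y_def sum.distrib[symmetric]
        by (intro sum.cong refl) (simp add: algebra_simps scaleR_diff_right)
      also have "(\<Sum>v\<in>p. \<Sum>w\<in>n. ((c v * (h \<bullet> v)) * (c w / \<alpha>)) *\<^sub>R w) = (\<Sum>w\<in>n. c w *\<^sub>R w)"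
      proof (subst sum.swap, rule sum.cong[OF refl])
        fix w
        have "(\<Sum>v\<in>p. ((c v * (h \<bullet> v)) * (c w / \<alpha>)) *\<^sub>R w) = (\<alpha> * (c w / \<alpha>)) *\<^sub>R w"
          unfolding \<alpha>_def by (simp only: sum_distrib_right scaleR_sum_left)
        then show "(\<Sum>v\<in>p. ((c v * (h \<bullet> v)) * (c w / \<alpha>)) *\<^sub>R w) = c w *\<^sub>R w"
          using \<alpha>0 by simp
      qed
      also have "(\<Sum>v\<in>p. \<Sum>w\<in>n. ((c w * (- (h \<bullet> w))) * (c v / \<alpha>)) *\<^sub>R v) =
          (\<Sum>v\<in>p. (\<beta> * (c v / \<alpha>)) *\<^sub>R v)"
        unfolding \<beta>_def by (simp only: sum_distrib_right scaleR_sum_left)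
      also have "\<dots> = (\<beta> / \<alpha>) *\<^sub>R (\<Sum>v\<in>p. c v *\<^sub>R v)"
        by (simp add: scaleR_sum_right)
      finally have "x = (\<Sum>v\<in>z. c v *\<^sub>R v) + (1 + - (\<beta> / \<alpha>)) *\<^sub>R (\<Sum>v\<in>p. c v *\<^sub>R v) + y"
        unfolding x by (subst split) (simp add: algebra_simps)
      moreover have "(\<Sum>v\<in>p. c v *\<^sub>R v) \<in> cone_over F ?W"
        using c sub base by (intro cone_over_sum cone_over_scale) auto
      ultimately show ?thesis
        using xz y ratio by (simp add: cone_over_add cone_over_scale)
    qed
  qed
qed

end

text \<open>
  The Weyl-Minkowski theorem for rational data.  The new generators are built from the old ones by
  rational operations only, so one and the same \<open>V\<close> works over every coefficient field.  Taking
  \<open>\<rat>\<close> shows that the elements of \<open>V\<close> are rational, taking all of \<open>\<real>\<close> describes the real cone.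
\<close>

lemma finitely_generated_Int_halfspaces:
  fixes V\<^sub>0 :: "'a::real_inner set"
  assumes "finite H" "finite V\<^sub>0" "\<And>h v. h \<in> H \<Longrightarrow> v \<in> V\<^sub>0 \<Longrightarrow> h \<bullet> v \<in> \<rat>"
  shows "\<exists>V. finite V \<and>
    (\<forall>F. real_subfield F \<longrightarrow> {x \<in> cone_over F V\<^sub>0. \<forall>h\<in>H. 0 \<le> h \<bullet> x} = cone_over F V)"
  using assms
proof (induction H rule: finite_induct)
  case empty
  then show ?case by (intro exI[of _ V\<^sub>0]) simp
next
  case (insert h H)
  then obtain V where V: "finite V"
    "\<And>F. real_subfield F \<Longrightarrow> {x \<in> cone_over F V\<^sub>0. \<forall>h\<in>H. 0 \<le> h \<bullet> x} = cone_over F V"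
    by auto
  have "V \<subseteq> cone_over \<rat> V"
    using V(1) cone_over_base[OF real_subfield_Rats] by auto
  also have "\<dots> \<subseteq> cone_over \<rat> V\<^sub>0"
    using V(2)[OF real_subfield_Rats] by auto
  also have "\<dots> \<subseteq> {v. h \<bullet> v \<in> \<rat>}"
    by (rule cone_over_least[OF real_subfield_Rats]) (use insert.prems in \<open>auto simp: inner_add_right\<close>)
  finally have rat: "h \<bullet> v \<in> \<rat>" if "v \<in> V" for v
    using that by auto
  define W where "W = {v \<in> V. 0 \<le> h \<bullet> v} \<union>
      (\<lambda>(v, w). (h \<bullet> v) *\<^sub>R w - (h \<bullet> w) *\<^sub>R v) ` ({v \<in> V. 0 < h \<bullet> v} \<times> {v \<in> V. h \<bullet> v < 0})"
  have "{x \<in> cone_over F V\<^sub>0. \<forall>h\<in>insert h H. 0 \<le> h \<bullet> x} = cone_over F W" if F: "real_subfield F" for F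
  proof -
    have "{x \<in> cone_over F V\<^sub>0. \<forall>h\<in>insert h H. 0 \<le> h \<bullet> x} = {x \<in> cone_over F V. 0 \<le> h \<bullet> x}"
      using V(2)[OF F] by auto
    also have "\<dots> = cone_over F W"
      unfolding W_def by (rule cone_over_Int_halfspace[OF F V(1)]) (use rat subfield_closed(1)[OF F] in auto)
    finally show ?thesis .
  qed
  moreover have "finite W" using V(1) by (simp add: W_def)
  ultimately show ?case by blast
qed

section \<open>Coefficients of polyhedral divisors\<close>

lemma is_lattice_basis:
  assumes "is_lattice M"
  obtains B where "finite B" "independent B" "B \<subseteq> M" "M \<subseteq> span B"
    "0 \<in> M" "\<And>x y. x \<in> M \<Longrightarrow> y \<in> M \<Longrightarrow> x + y \<in> M" "\<And>x n. x \<in> M \<Longrightarrow> of_int n *\<^sub>R x \<in> M"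
    "\<And>x. x \<in> M \<Longrightarrow> \<exists>c::_ \<Rightarrow> int. x = (\<Sum>b\<in>B. of_int (c b) *\<^sub>R b)"
proof -
  obtain B where B: "independent B" and M: "M = range (\<lambda>c::'a \<Rightarrow> int. \<Sum>b\<in>B. of_int (c b) *\<^sub>R b)"
    using assms unfolding is_lattice_def by blast
  have fin: "finite B" using B by (rule independent_imp_finite)
  show thesis
  proof
    show "B \<subseteq> M"
    proof
      fix b assume b: "b \<in> B"
      have *: "b = (\<Sum>b'\<in>B. of_int (if b' = b then 1 else 0) *\<^sub>R b')"
        using b fin by (simp add: if_distrib[of of_int] if_distrib [of "\<lambda>c. c *\<^sub>R _"] if_distribR cong: if_cong)
      show "b \<in> M" unfolding M by (rule range_eqI) (rule *)
    qed
    show "M \<subseteq> span B"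
      unfolding M by (clarify, intro span_sum span_scale span_base)
    show "0 \<in> M" unfolding M by (rule range_eqI[of _ _ "\<lambda>_. 0"]) simp
    show "x + y \<in> M" if xy: "x \<in> M" "y \<in> M" for x y
    proof -
      obtain c d :: "'a \<Rightarrow> int" where
        "x = (\<Sum>b\<in>B. of_int (c b) *\<^sub>R b)" "y = (\<Sum>b\<in>B. of_int (d b) *\<^sub>R b)"
        using xy unfolding M by blast
      then have "x + y = (\<Sum>b\<in>B. of_int (c b + d b) *\<^sub>R b)"
        by (simp add: scaleR_add_left sum.distrib)
      then show ?thesis unfolding M by (rule range_eqI[of _ _ "\<lambda>b. c b + d b"])
    qed
    show "of_int n *\<^sub>R x \<in> M" if x: "x \<in> M" for x n
    proof -
      obtain c :: "'a \<Rightarrow> int" where "x = (\<Sum>b\<in>B. of_int (c b) *\<^sub>R b)"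
        using x unfolding M by blast
      then have "of_int n *\<^sub>R x = (\<Sum>b\<in>B. of_int (n * c b) *\<^sub>R b)"
        by (simp add: scaleR_sum_right)
      then show ?thesis unfolding M by (rule range_eqI[of _ _ "\<lambda>b. n * c b"])
    qed
  qed (use fin B M in auto)
qed

text \<open>
  Coordinate functionals are represented by vectors through the inner product.  As the lattice need not
  span the ambient space, the representing vectors have to be projected to the span.
\<close>

lemma dual_basis:
  fixes B :: "'a::euclidean_space set"
  assumes "independent B"
  obtains d where "\<And>b. b \<in> B \<Longrightarrow> d b \<in> span B"
    "\<And>b b'. b \<in> B \<Longrightarrow> b' \<in> B \<Longrightarrow> d b \<bullet> b' = (if b' = b then 1 else 0)"
proof -
  have "\<exists>y\<in>span B. \<forall>b'\<in>B. y \<bullet> b' = (if b' = b then 1 else 0)" for b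
  proof -
    obtain f :: "'a \<Rightarrow> real" where f: "linear f" "\<And>b'. b' \<in> B \<Longrightarrow> f b' = (if b' = b then 1 else 0)"
      using linear_independent_extend[OF assms, of "\<lambda>b'. if b' = b then 1 else 0"] by blast
    obtain y z where y: "y \<in> span B" and z: "\<And>w. w \<in> span B \<Longrightarrow> orthogonal z w"
      and yz: "adjoint f 1 = y + z"
      using orthogonal_subspace_decomp_exists[of B "adjoint f 1"] by metis
    have "y \<bullet> b' = f b'" if "b' \<in> B" for b'
    proof -
      have "b' \<bullet> adjoint f 1 = f b'"
        using adjoint_works[OF f(1), of b' 1] by simp
      moreover have "z \<bullet> b' = 0"
        using z[of b'] that by (simp add: orthogonal_def span_base)
      ultimately show ?thesis
        by (simp add: yz inner_add_right inner_commute)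
    qed
    then show ?thesis using y f(2) by (intro bexI[of _ y]) auto
  qed
  then obtain d where "\<And>b. d b \<in> span B \<and> (\<forall>b'\<in>B. d b \<bullet> b' = (if b' = b then 1 else 0))"
    by metis
  then show thesis using that by blast
qed

text \<open>
  A basis of \<open>(\<int> \<times> N)\<^sub>\<rat>\<close> together with its negatives generates this rational vector space as a cone, which
  makes it a possible starting point for cutting with halfspaces.
\<close>

lemma rat_cochars_eq_cone_over:
  assumes "is_lattice M"
  shows "\<exists>V. finite V \<and> cone_over \<rat> V = rat_cochars M"
proof -
  obtain B where B: "finite B" "independent B" "B \<subseteq> M" "M \<subseteq> span B"
    and int: "\<And>x. x \<in> M \<Longrightarrow> \<exists>c::_ \<Rightarrow> int. x = (\<Sum>b\<in>B. of_int (c b) *\<^sub>R b)"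
    using assms by (elim is_lattice_basis) blast
  have span: "span M = span B"
    using B by (simp add: span_eq order.trans[OF _ span_superset])
  obtain d where d: "\<And>b. b \<in> B \<Longrightarrow> d b \<in> span B"
    "\<And>b b'. b \<in> B \<Longrightarrow> b' \<in> B \<Longrightarrow> d b \<bullet> b' = (if b' = b then 1 else 0)"
    using dual_basis[OF B(2)] by metis
  define N where "N = {v \<in> span M. \<forall>u\<in>M. v \<bullet> u \<in> \<rat>}"
  define W where "W = d ` B \<union> uminus ` d ` B"
  have "cone_over \<rat> W = N"
  proof
    have dN: "d b \<in> N" if b: "b \<in> B" for b
      unfolding N_def span
    proof (clarsimp simp: d(1)[OF b])
      fix u assume "u \<in> M"
      then obtain c :: "_ \<Rightarrow> int" where "u = (\<Sum>b\<in>B. of_int (c b) *\<^sub>R b)"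
        using int by blast
      then have "d b \<bullet> u = (\<Sum>b'\<in>B. of_int (c b') * (d b \<bullet> b'))"
        by (simp add: inner_sum_right)
      also have "\<dots> \<in> \<rat>"
        using d(2) b by (intro subfield_sum[OF real_subfield_Rats]) auto
      finally show "d b \<bullet> u \<in> \<rat>" .
    qed
    have "W \<subseteq> N"
      using dN unfolding W_def by (auto simp: N_def span_neg)
    then show "cone_over \<rat> W \<subseteq> N"
      by (rule cone_over_least[OF real_subfield_Rats])
        (auto simp: N_def span_zero span_add span_scale inner_add_left)
    show "N \<subseteq> cone_over \<rat> W"
    proof
      fix v assume v: "v \<in> N"
      define v' where "v' = (\<Sum>b\<in>B. (v \<bullet> b) *\<^sub>R d b)"
      have diff: "v - v' \<in> span B"
        using v d(1) unfolding v'_def N_def span by (auto intro!: span_diff span_sum span_scale)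
      have "orthogonal (v - v') b" if b: "b \<in> B" for b
      proof -
        have "v' \<bullet> b = (\<Sum>b'\<in>B. if b = b' then v \<bullet> b' else 0)"
          unfolding v'_def inner_sum_left using b d(2) by (intro sum.cong) auto
        then show ?thesis
          using b B(1) by (simp add: orthogonal_def inner_diff_left)
      qed
      from orthogonal_to_span[OF diff this] have "v = v'"
        by (simp add: orthogonal_self)
      also have "v' \<in> cone_over \<rat> W"
        unfolding v'_def W_def
        by (rule cone_over_symmetric[OF real_subfield_Rats B(1)]) (use v B in \<open>auto simp: N_def\<close>)
      finally show "v \<in> cone_over \<rat> W" .
    qed
  qed
  moreover have "finite W" using B by (simp add: W_def)
  ultimately have "cone_over \<rat> ((\<lambda>v. (v, 0)) ` {1, - 1 :: real} \<union> Pair 0 ` W) = \<rat> \<times> N"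
    using cone_over_Times[OF real_subfield_Rats, of "{1, - 1 :: real}" W]
    by (simp only: cone_over_1_minus_1[OF real_subfield_Rats] finite.intros simp_thms)
  also have "\<rat> \<times> N = rat_cochars M"
    by (auto simp: rat_cochars_def N_def)
  finally show ?thesis
    using \<open>finite W\<close> by (intro exI[of _ "(\<lambda>v. (v, 0)) ` {1, - 1 :: real} \<union> Pair 0 ` W"]) simp
qed

lemma rat_cochars_closed:
  "0 \<in> rat_cochars M" "v \<in> rat_cochars M \<Longrightarrow> v' \<in> rat_cochars M \<Longrightarrow> v + v' \<in> rat_cochars M"
  "v \<in> rat_cochars M \<Longrightarrow> q \<in> \<rat> \<Longrightarrow> q *\<^sub>R v \<in> rat_cochars M"
  by (auto simp: rat_cochars_def span_zero span_add span_scale inner_add_left)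

lemma rat_cochars_inner:
  assumes "v \<in> rat_cochars M" "w \<in> \<int> \<times> M"
  shows "v \<bullet> w \<in> \<rat>"
proof -
  have "fst w \<in> \<rat>" using assms(2) Ints_subset_Rats by auto
  then show ?thesis
    using assms by (cases w) (auto simp: rat_cochars_def inner_prod_def)
qed

text \<open>
  A rational polyhedron is the sum of a polytope and its tail cone.  Only the consequence for minima is
  stated: a linear form that is nonnegative on the tail cone attains its minimum on one of finitely many
  points.  They are found by homogenizing, i.e. by adding a coordinate \<open>t \<ge> 0\<close> with the
  polyhedron at height \<open>t = 1\<close>: generators of the resulting cone of positive height are scaled to
  height one, those of height zero lie in the tail cone.
\<close>

lemma rat_polyhedron_generators:
  assumes M: "is_lattice M" and \<Delta>: "rat_polyhedron M \<Delta>"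
  shows "\<exists>A. finite A \<and> A \<subseteq> \<Delta> \<and>
    (\<forall>w. (\<forall>v\<in>tailcone M \<Delta>. 0 \<le> v \<bullet> w) \<longrightarrow> (\<forall>v\<in>\<Delta>. \<exists>a\<in>A. a \<bullet> w \<le> v \<bullet> w))"
proof -
  obtain H where H: "finite H" "H \<subseteq> (\<int> \<times> M) \<times> \<rat>"
    and \<Delta>: "\<Delta> = {v \<in> rat_cochars M. \<forall>x\<in>H. snd x \<le> v \<bullet> fst x}"
    using \<Delta> unfolding rat_polyhedron_def case_prod_unfold by blast
  obtain U where U: "finite U" "cone_over \<rat> U = rat_cochars M"
    using rat_cochars_eq_cone_over[OF M] by blast
  have pos: "cone_over \<rat> {1::real} = {t \<in> \<rat>. 0 \<le> t}"
  proof
    show "{t \<in> \<rat>. 0 \<le> t} \<subseteq> cone_over \<rat> {1::real}"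
      unfolding cone_over_def by (auto intro: exI[of _ "\<lambda>_. t" for t])
  qed (auto simp: cone_over_def)
  define V\<^sub>0 where "V\<^sub>0 = (\<lambda>v. (v, 0::real)) ` U \<union> Pair 0 ` {1}"
  have V\<^sub>0: "finite V\<^sub>0" "cone_over \<rat> V\<^sub>0 = rat_cochars M \<times> {t \<in> \<rat>. 0 \<le> t}"
    using U cone_over_Times[OF real_subfield_Rats, of U "{1}"] pos by (auto simp: V\<^sub>0_def)
  define H' where "H' = (\<lambda>x. (fst x, - snd x)) ` H"
  have rat: "h \<bullet> v \<in> \<rat>" if hv: "h \<in> H'" "v \<in> V\<^sub>0" for h v
  proof -
    have "v \<in> rat_cochars M \<times> {t \<in> \<rat>. 0 \<le> t}"
      using cone_over_base[OF real_subfield_Rats V\<^sub>0(1) hv(2)] unfolding V\<^sub>0(2) .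
    then obtain a t where v: "v = (a, t)" "a \<in> rat_cochars M" "t \<in> \<rat>" by blast
    obtain x where x: "x \<in> H" "h = (fst x, - snd x)"
      using hv(1) unfolding H'_def by blast
    then have "fst x \<in> \<int> \<times> M" "snd x \<in> \<rat>"
      using H(2) by auto
    then have "a \<bullet> fst x \<in> \<rat>" "snd x * t \<in> \<rat>"
      using rat_cochars_inner[OF v(2)] v(3) by auto
    then show ?thesis
      unfolding v(1) x(2) by (simp add: inner_commute[of "fst x"])
  qed
  have "finite H'" using H(1) by (simp add: H'_def)
  from finitely_generated_Int_halfspaces[OF this V\<^sub>0(1) rat] obtain V where V: "finite V"
    "{x \<in> cone_over \<rat> V\<^sub>0. \<forall>h\<in>H'. 0 \<le> h \<bullet> x} = cone_over \<rat> V"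
    using real_subfield_Rats by blast
  have H': "(\<forall>h\<in>H'. 0 \<le> h \<bullet> (v, t)) \<longleftrightarrow> (\<forall>x\<in>H. snd x * t \<le> v \<bullet> fst x)" for v t
    unfolding H'_def by (simp add: inner_commute[of v])
  have cone: "(v, t) \<in> cone_over \<rat> V \<longleftrightarrow>
      v \<in> rat_cochars M \<and> t \<in> \<rat> \<and> 0 \<le> t \<and> (\<forall>x\<in>H. snd x * t \<le> v \<bullet> fst x)" for v t
    using H'[of v t] unfolding V(2)[symmetric] V\<^sub>0(2) by blast
  define A where "A = (\<lambda>x. (1 / snd x) *\<^sub>R fst x) ` {x \<in> V. 0 < snd x}"
  have inV: "v \<in> rat_cochars M" "t \<in> \<rat>" "0 \<le> t" "\<And>x. x \<in> H \<Longrightarrow> snd x * t \<le> v \<bullet> fst x"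
    if "(v, t) \<in> V" for v t
    using cone_over_base[OF real_subfield_Rats V(1) that] unfolding cone by blast+
  have fin: "finite A"
    unfolding A_def by (intro finite_imageI finite_subset[OF _ V(1)]) auto
  have sub: "A \<subseteq> \<Delta>"
  proof
    fix a assume "a \<in> A"
    then obtain y where y: "y \<in> V" "0 < snd y" and a: "a = (1 / snd y) *\<^sub>R fst y"
      unfolding A_def by blast
    then have yV: "(fst y, snd y) \<in> V" by simp
    have "a \<in> rat_cochars M"
      unfolding a using inV(1,2)[OF yV] by (intro rat_cochars_closed(3) Rats_divide) simp_all
    moreover have "snd x \<le> a \<bullet> fst x" if "x \<in> H" for x
      using inV(4)[OF yV that] y a by (simp add: field_simps)
    ultimately show "a \<in> \<Delta>" unfolding \<Delta> by blast
  qed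
  have min: "\<exists>a\<in>A. a \<bullet> w \<le> v \<bullet> w"
    if w: "\<forall>v\<in>tailcone M \<Delta>. 0 \<le> v \<bullet> w" and v: "v \<in> \<Delta>" for w v
  proof (rule ccontr)
    assume "\<not> ?thesis"
    then have less: "v \<bullet> w < a \<bullet> w" if "a \<in> A" for a
      using that by auto
    have "(v, 1) \<in> cone_over \<rat> V"
      using v unfolding cone \<Delta> by simp
    then obtain c where c: "\<And>x. x \<in> V \<Longrightarrow> 0 \<le> c x" and sum: "(v, 1) = (\<Sum>x\<in>V. c x *\<^sub>R x)"
      unfolding cone_over_def by blast
    have v_eq: "v = (\<Sum>x\<in>V. c x *\<^sub>R fst x)" and one: "1 = (\<Sum>x\<in>V. c x * snd x)"
      using arg_cong[OF sum, of fst] arg_cong[OF sum, of snd] by (simp_all add: fst_sum snd_sum)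
    \<comment> \<open>A functional that vanishes at \<open>(v, 1)\<close>, but would be positive on every generator of positive height.\<close>
    define f where "f = (\<lambda>x. fst x \<bullet> w - snd x * (v \<bullet> w))"
    have f_pos: "0 < f x" if "x \<in> V" "snd x > 0" for x
    proof -
      have "(1 / snd x) *\<^sub>R fst x \<in> A"
        unfolding A_def using that by blast
      from less[OF this] show ?thesis
        using that(2) by (simp add: f_def field_simps)
    qed
    \<comment> \<open>Generators of height zero lie in the tail cone.\<close>
    have f_nonneg: "0 \<le> f x" if "x \<in> V" for x
    proof (cases "snd x = 0")
      case True
      obtain a where x: "x = (a, 0)" using True by (cases x) auto
      have aV: "(a, 0) \<in> V" using that x by simp
      have "d + a \<in> \<Delta>" if "d \<in> \<Delta>" for d
        using inV(4)[OF aV] inV(1)[OF aV] that unfolding \<Delta>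
        by (simp add: inner_add_left rat_cochars_closed add_increasing2)
      then have "a \<in> tailcone M \<Delta>"
        using inV(1)[OF aV] by (simp add: tailcone_def)
      then show ?thesis using w x by (simp add: f_def)
    next
      case False
      then show ?thesis using f_pos[OF that] inV(3)[of "fst x" "snd x"] that by fastforce
    qed
    have "(\<Sum>x\<in>V. c x * f x) = (\<Sum>x\<in>V. c x *\<^sub>R fst x) \<bullet> w - (\<Sum>x\<in>V. c x * snd x) * (v \<bullet> w)"
      by (simp add: f_def inner_sum_left sum_distrib_right right_diff_distrib sum_subtractf mult.assoc)
    also have "\<dots> = 0"
      unfolding v_eq[symmetric] one[symmetric] by simp
    finally have "\<forall>x\<in>V. c x * f x = 0"
      using V(1) c f_nonneg by (subst (asm) sum_nonneg_eq_0_iff) auto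
    then have "c x * snd x = 0" if "x \<in> V" for x
      using that f_pos[OF that] inV(3)[of "fst x" "snd x"] by fastforce
    then have "(\<Sum>x\<in>V. c x * snd x) = 0" by (intro sum.neutral) blast
    then show False using one by linarith
  qed
  show ?thesis
    using fin sub min by (intro exI[of _ A] conjI allI impI ballI)
qed

text \<open>
  An empty coefficient is covered by an empty set of generators, over which the infimum is \<open>\<infinity>\<close>.
\<close>

lemma polyhedral_divisor_generators:
  assumes M: "is_lattice M" and D: "polyhedral_divisor M m P \<sigma> \<Delta>"
  shows "\<exists>A. \<forall>i\<le>m. finite (A i) \<and> A i \<subseteq> rat_cochars M \<and>
    (\<forall>w\<in>dual_cone M \<sigma>. pd_eval (\<Delta> i) w = (INF v\<in>A i. ereal (v \<bullet> w)))"
proof -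
  have "\<exists>A. finite A \<and> A \<subseteq> rat_cochars M \<and>
    (\<forall>w\<in>dual_cone M \<sigma>. pd_eval (\<Delta> i) w = (INF v\<in>A. ereal (v \<bullet> w)))" if "i \<le> m" for i
  proof (cases "\<Delta> i = {}")
    case True
    then show ?thesis by (intro exI[of _ "{}"]) (auto simp: pd_eval_def)
  next
    case False
    then have \<Delta>: "rat_polyhedron M (\<Delta> i)" "tailcone M (\<Delta> i) = \<sigma>"
      using D that by (auto simp: polyhedral_divisor_def)
    obtain A where A: "finite A" "A \<subseteq> \<Delta> i"
      and min: "\<And>w v. \<lbrakk>\<forall>v\<in>\<sigma>. 0 \<le> v \<bullet> w; v \<in> \<Delta> i\<rbrakk> \<Longrightarrow> \<exists>a\<in>A. a \<bullet> w \<le> v \<bullet> w"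
      using rat_polyhedron_generators[OF M \<Delta>(1)] \<Delta>(2) by metis
    have "A \<subseteq> rat_cochars M"
      using A \<Delta> by (auto simp: rat_polyhedron_def)
    moreover have "pd_eval (\<Delta> i) w = (INF v\<in>A. ereal (v \<bullet> w))" if "w \<in> dual_cone M \<sigma>" for w
      unfolding pd_eval_def
    proof (rule antisym)
      show "(INF v\<in>A. ereal (v \<bullet> w)) \<le> (INF v\<in>\<Delta> i. ereal (v \<bullet> w))"
        using min[of w] that by (intro INF_mono) (auto simp: dual_cone_def)
      show "(INF v\<in>\<Delta> i. ereal (v \<bullet> w)) \<le> (INF v\<in>A. ereal (v \<bullet> w))"
        using A by (intro INF_superset_mono) auto
    qed
    ultimately show ?thesis using A by blast
  qed
  then show ?thesis by metis
qed

lemma INF_finite_cases: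
  fixes f :: "'a \<Rightarrow> real"
  assumes "finite A"
  obtains "A = {}" "(INF v\<in>A. ereal (f v)) = \<infinity>" |
    a where "a \<in> A" "(INF v\<in>A. ereal (f v)) = ereal (f a)" "\<And>v. v \<in> A \<Longrightarrow> f a \<le> f v"
proof (cases "A = {}")
  case True
  then show ?thesis using that(1) by (simp add: top_ereal_def)
next
  case False
  then obtain a where a: "a \<in> A" "\<And>v. v \<in> A \<Longrightarrow> f a \<le> f v"
    using arg_min_if_finite[OF assms, of f] that by (metis not_less)
  then have "(INF v\<in>A. ereal (f v)) = ereal (f a)"
    by (intro antisym INF_lower INF_greatest) auto
  then show ?thesis using that(2) a by blast
qed

lemma uminus_INF_le_iff:
  fixes f :: "'a \<Rightarrow> real"
  shows "- (INF v\<in>A. ereal (f v)) \<le> ereal l \<longleftrightarrow> (\<forall>v\<in>A. 0 \<le> f v + l)"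
proof -
  have "- (INF v\<in>A. ereal (f v)) \<le> ereal l \<longleftrightarrow> ereal (- l) \<le> (INF v\<in>A. ereal (f v))"
    by (subst ereal_uminus_le_reorder) simp
  also have "\<dots> \<longleftrightarrow> (\<forall>v\<in>A. 0 \<le> f v + l)"
    by (auto simp: le_INF_iff)
  finally show ?thesis .
qed

text \<open>
  A bound by a sum of piecewise linear functions is a finite system of linear inequalities, one for each choice
  of a linear piece in every summand.  If some \<open>A i\<close> is empty then there are no choices, in accordance with
  the bound \<open>\<infinity>\<close>.
\<close>

lemma le_sum_INF_iff:
  fixes f :: "'a \<Rightarrow> real" and A :: "'i \<Rightarrow> 'a set"
  assumes I: "finite I" and A: "\<And>i. i \<in> I \<Longrightarrow> finite (A i)"
  shows "ereal l \<le> (\<Sum>i\<in>I. INF v\<in>A i. ereal (f v)) \<longleftrightarrow>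
    (\<forall>c\<in>Pi\<^sub>E I A. l \<le> (\<Sum>i\<in>I. f (c i)))"
proof (cases "\<exists>i\<in>I. A i = {}")
  case True
  then obtain i where i: "i \<in> I" "A i = {}" by blast
  then have "(INF v\<in>A i. ereal (f v)) = \<infinity>" by (simp add: top_ereal_def)
  then have "(\<Sum>i\<in>I. INF v\<in>A i. ereal (f v)) = \<infinity>"
    using i I by (subst sum_Pinfty) blast
  moreover have "Pi\<^sub>E I A = {}"
    using i by (auto simp: PiE_eq_empty_iff)
  ultimately show ?thesis by simp
next
  case False
  have "\<exists>a. a \<in> A i \<and> (INF v\<in>A i. ereal (f v)) = ereal (f a) \<and> (\<forall>v\<in>A i. f a \<le> f v)"
    if "i \<in> I" for i
    using INF_finite_cases[OF A[OF that], of f] False that by metis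
  then obtain a where a: "\<And>i. i \<in> I \<Longrightarrow> a i \<in> A i"
    "\<And>i. i \<in> I \<Longrightarrow> (INF v\<in>A i. ereal (f v)) = ereal (f (a i))"
    "\<And>i v. i \<in> I \<Longrightarrow> v \<in> A i \<Longrightarrow> f (a i) \<le> f v"
    by metis
  have "(\<Sum>i\<in>I. INF v\<in>A i. ereal (f v)) = ereal (\<Sum>i\<in>I. f (a i))"
    by (simp add: a(2))
  moreover have "(\<forall>c\<in>Pi\<^sub>E I A. l \<le> (\<Sum>i\<in>I. f (c i))) \<longleftrightarrow> l \<le> (\<Sum>i\<in>I. f (a i))"
  proof
    assume "\<forall>c\<in>Pi\<^sub>E I A. l \<le> (\<Sum>i\<in>I. f (c i))"
    moreover have "restrict a I \<in> Pi\<^sub>E I A" using a(1) by auto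
    ultimately show "l \<le> (\<Sum>i\<in>I. f (a i))" by fastforce
  next
    assume "l \<le> (\<Sum>i\<in>I. f (a i))"
    moreover have "(\<Sum>i\<in>I. f (a i)) \<le> (\<Sum>i\<in>I. f (c i))" if "c \<in> Pi\<^sub>E I A" for c
      by (intro sum_mono a(3)) (use that in auto)
    ultimately show "\<forall>c\<in>Pi\<^sub>E I A. l \<le> (\<Sum>i\<in>I. f (c i))"
      by fastforce
  qed
  ultimately show ?thesis by simp
qed

section \<open>The cone of weights and orders\<close>

lemma cone_over_UNIV:
  assumes "finite V"
  shows "cone_over UNIV V = convex_cone hull V"
proof
  show "cone_over UNIV V \<subseteq> convex_cone hull V"
    by (rule cone_over_least[OF real_subfield_UNIV])
      (auto intro: hull_inc convex_cone_hull_contains_0 convex_cone_hull_add convex_cone_hull_mul)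
  have "convex_cone (cone_over UNIV V)"
    unfolding convex_cone_iff
    using cone_over_0[OF real_subfield_UNIV] cone_over_add[OF real_subfield_UNIV]
      cone_over_scale[OF real_subfield_UNIV] by auto
  then show "convex_cone hull V \<subseteq> cone_over UNIV V"
    using cone_over_base[OF real_subfield_UNIV assms] by (intro hull_minimal) auto
qed

lemma cone_over_UNIV_symmetric:
  assumes "finite B"
  shows "cone_over UNIV (B \<union> uminus ` B) = span B"
proof
  show "cone_over UNIV (B \<union> uminus ` B) \<subseteq> span B"
    by (rule cone_over_least[OF real_subfield_UNIV])
      (auto intro: span_base span_neg span_zero span_add span_scale)
  show "span B \<subseteq> cone_over UNIV (B \<union> uminus ` B)"
  proof
    fix x assume "x \<in> span B"
    then obtain c where "x = (\<Sum>b\<in>B. c b *\<^sub>R b)"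
      using span_finite[OF assms] by auto
    then show "x \<in> cone_over UNIV (B \<union> uminus ` B)"
      using cone_over_symmetric[OF real_subfield_UNIV assms, of c "\<lambda>b. b"] by simp
  qed
qed

lemma common_denominator:
  assumes "finite R" "R \<subseteq> \<rat>"
  shows "\<exists>n>0. \<forall>r\<in>R. real n * r \<in> \<int>"
  using assms
proof (induction rule: finite_induct)
  case empty
  then show ?case by (intro exI[of _ 1]) auto
next
  case (insert r R)
  then obtain n where n: "n > 0" "\<And>r. r \<in> R \<Longrightarrow> real n * r \<in> \<int>" by auto
  obtain p q :: int where pq: "q > 0" "r = of_int p / of_int q"
    using insert.prems by (auto elim: Rats_cases')
  have q: "real (nat q) = of_int q" using pq(1) by simp
  have "real (nat q * n) * s \<in> \<int>" if "s \<in> insert r R" for s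
  proof (cases "s = r")
    case True
    have "real (nat q * n) * s = of_int (int n * p)"
      using pq True q by simp
    then show ?thesis by (simp only: Ints_of_int)
  next
    case False
    have "real (nat q * n) * s = of_int q * (real n * s)"
      by (simp add: q)
    also have "\<dots> \<in> \<int>"
      using Ints_mult[OF Ints_of_int n(2)[of s]] that False by blast
    finally show ?thesis .
  qed
  then show ?case
    using n(1) pq(1) by (intro exI[of _ "nat q * n"]) auto
qed

text \<open>
  \<open>L\<close> stands for a lattice.  The elements with a multiple in \<open>L\<close> form a rational vector space.
\<close>

lemma cone_over_Rats_clear_denominators:
  assumes V: "V \<subseteq> L" and L0: "0 \<in> L"
    and add: "\<And>x y. x \<in> L \<Longrightarrow> y \<in> L \<Longrightarrow> x + y \<in> L"
    and scale: "\<And>x n. x \<in> L \<Longrightarrow> of_int n *\<^sub>R x \<in> L"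
    and x: "x \<in> cone_over \<rat> V"
  shows "\<exists>n>0. real n *\<^sub>R x \<in> L"
proof -
  define K where "K = {x. \<exists>n>0. real n *\<^sub>R x \<in> L}"
  have natscale: "real n *\<^sub>R x \<in> L" if "x \<in> L" for n x
    using scale[OF that, of "int n"] by simp
  have "cone_over \<rat> V \<subseteq> K"
  proof (rule cone_over_least[OF real_subfield_Rats])
    show "V \<subseteq> K"
    proof
      fix v assume "v \<in> V"
      then show "v \<in> K" unfolding K_def using V by (auto intro!: exI[of _ 1])
    qed
    show "0 \<in> K" unfolding K_def using L0 by (auto intro!: exI[of _ 1])
  next
    fix x y assume "x \<in> K" "y \<in> K"
    then obtain n n' where n: "n > 0" "n' > 0" "real n *\<^sub>R x \<in> L" "real n' *\<^sub>R y \<in> L"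
      unfolding K_def by blast
    have "real (n * n') *\<^sub>R (x + y) = real n' *\<^sub>R (real n *\<^sub>R x) + real n *\<^sub>R (real n' *\<^sub>R y)"
      by (simp add: scaleR_add_right mult.commute)
    also have "\<dots> \<in> L"
      by (intro add natscale n)
    finally show "x + y \<in> K"
      unfolding K_def using n(1,2) by (auto intro!: exI[of _ "n * n'"])
  next
    fix a :: real and x assume a: "a \<in> \<rat>" and "x \<in> K"
    then obtain n where n: "n > 0" "real n *\<^sub>R x \<in> L"
      unfolding K_def by blast
    obtain p q :: int where pq: "q > 0" "a = of_int p / of_int q"
      using a by (auto elim: Rats_cases')
    have "real (nat q * n) *\<^sub>R (a *\<^sub>R x) = of_int p *\<^sub>R (real n *\<^sub>R x)"
      using pq by (simp add: mult.commute)
    also have "\<dots> \<in> L"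
      by (intro scale n)
    finally show "a *\<^sub>R x \<in> K"
      unfolding K_def using n(1) pq(1) by (auto intro!: exI[of _ "nat q * n"])
  qed
  then show ?thesis
    using x unfolding K_def by blast
qed

text \<open>
  It is enough to test the duality condition on generators of \<open>\<sigma>\<close>.
\<close>

lemma dual_cone_halfspaces:
  assumes M: "is_lattice M" and \<sigma>: "rat_polyhedral_cone M \<sigma>"
  obtains V where "finite V" "V \<subseteq> rat_cochars M"
    "dual_cone M \<sigma> = {w \<in> UNIV \<times> span M. \<forall>v\<in>V. 0 \<le> v \<bullet> w}"
proof -
  obtain H where H: "finite H" "H \<subseteq> \<int> \<times> M" and \<sigma>: "\<sigma> = {v \<in> rat_cochars M. \<forall>w\<in>H. 0 \<le> v \<bullet> w}"
    using \<sigma> unfolding rat_polyhedral_cone_def by blast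
  obtain U where U: "finite U" "cone_over \<rat> U = rat_cochars M"
    using rat_cochars_eq_cone_over[OF M] by blast
  have rat: "h \<bullet> v \<in> \<rat>" if hv: "h \<in> H" "v \<in> U" for h v
  proof -
    have "v \<in> rat_cochars M"
      using cone_over_base[OF real_subfield_Rats U(1) hv(2)] U(2) by simp
    then show ?thesis
      using rat_cochars_inner[of v M h] hv(1) H(2) by (auto simp: inner_commute[of h])
  qed
  from finitely_generated_Int_halfspaces[OF H(1) U(1) rat] obtain V where V: "finite V"
    "{x \<in> cone_over \<rat> U. \<forall>h\<in>H. 0 \<le> h \<bullet> x} = cone_over \<rat> V"
    using real_subfield_Rats by blast
  have cone: "\<sigma> = cone_over \<rat> V"
    unfolding \<sigma> V(2)[symmetric] U(2) by (simp add: inner_commute)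
  have sub: "V \<subseteq> \<sigma>"
    using cone_over_base[OF real_subfield_Rats V(1)] unfolding cone by blast
  have "dual_cone M \<sigma> = {w \<in> UNIV \<times> span M. \<forall>v\<in>V. 0 \<le> v \<bullet> w}"
  proof
    show "dual_cone M \<sigma> \<subseteq> {w \<in> UNIV \<times> span M. \<forall>v\<in>V. 0 \<le> v \<bullet> w}"
      using sub unfolding dual_cone_def by blast
    have "0 \<le> v \<bullet> w" if w: "\<forall>v\<in>V. 0 \<le> v \<bullet> w" and v: "v \<in> \<sigma>" for v w
    proof -
      have "cone_over \<rat> V \<subseteq> {v. 0 \<le> v \<bullet> w}"
        by (rule cone_over_least[OF real_subfield_Rats]) (use w in \<open>auto simp: inner_add_left\<close>)
      then show ?thesis using v cone by blast
    qed
    then show "{w \<in> UNIV \<times> span M. \<forall>v\<in>V. 0 \<le> v \<bullet> w} \<subseteq> dual_cone M \<sigma>"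
      unfolding dual_cone_def by blast
  qed
  then show thesis
    using that V(1) sub \<sigma> by blast
qed

text \<open>
  The real cone over the polyhedron whose image the Newton-Okounkov body is to be: the polyhedron of
  pairs of a weight \<open>u\<close> and an order \<open>l\<close> is the slice at \<open>k = 1\<close>, where \<open>w = (k, u)\<close>.
\<close>

definition section_cone ::
  "'m::euclidean_space set \<Rightarrow> nat \<Rightarrow> nat \<Rightarrow> (real \<times> 'm) set \<Rightarrow> (nat \<Rightarrow> (real \<times> 'm) set) \<Rightarrow>
   ((real \<times> 'm) \<times> real) set" where
  "section_cone M m j \<sigma> \<Delta> = {(w, l). w \<in> dual_cone M \<sigma> \<and>
     - pd_eval (\<Delta> j) w \<le> ereal l \<and> ereal l \<le> (\<Sum>i\<in>{..m} - {j}. pd_eval (\<Delta> i) w)}"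

text \<open>
  The semigroup of those \<open>((k, u), l)\<close> for which there is a section of degree \<open>(k, u)\<close> that vanishes to
  order \<open>l\<close> at \<open>P j\<close>; the rounding down is that of the graded pieces.
\<close>

definition section_degrees ::
  "'m::euclidean_space set \<Rightarrow> nat \<Rightarrow> nat \<Rightarrow> (real \<times> 'm) set \<Rightarrow> (nat \<Rightarrow> (real \<times> 'm) set) \<Rightarrow>
   ((real \<times> 'm) \<times> real) set" where
  "section_degrees M m j \<sigma> \<Delta> = {(w, l). w \<in> \<int> \<times> M \<and> l \<in> \<int> \<and> w \<in> dual_cone M \<sigma> \<and>
     - ereal_floor (pd_eval (\<Delta> j) w) \<le> ereal l \<and>
     ereal l \<le> (\<Sum>i\<in>{..m} - {j}. ereal_floor (pd_eval (\<Delta> i) w))}"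

lemma ereal_floor_le: "ereal_floor x \<le> x"
  by (cases x) (auto simp: ereal_floor_def)

lemma section_degrees_subset: "section_degrees M m j \<sigma> \<Delta> \<subseteq> section_cone M m j \<sigma> \<Delta>"
proof -
  have "- pd_eval (\<Delta> j) w \<le> ereal l" if "- ereal_floor (pd_eval (\<Delta> j) w) \<le> ereal l" for w l
    using that by (rule order.trans[rotated]) (simp add: ereal_floor_le)
  moreover have "ereal l \<le> (\<Sum>i\<in>{..m} - {j}. pd_eval (\<Delta> i) w)"
    if "ereal l \<le> (\<Sum>i\<in>{..m} - {j}. ereal_floor (pd_eval (\<Delta> i) w))" for w l
    using that by (rule order.trans) (intro sum_mono ereal_floor_le)
  ultimately show ?thesis
    unfolding section_degrees_def section_cone_def by blast
qed

text \<open>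
  The cone is cut out by finitely many rational halfspaces, so it has finitely many rational generators.  The
  rounding that separates it from the semigroup is without effect on a multiple of a generator for which the point
  itself and all values of the finitely many linear pieces are integral.
\<close>

lemma section_cone_generators:
  assumes M: "is_lattice M" and D: "polyhedral_divisor M m P \<sigma> \<Delta>" and j: "j \<le> m"
  obtains V where "finite V" "section_cone M m j \<sigma> \<Delta> = cone_over UNIV V"
    "\<And>x. x \<in> V \<Longrightarrow> \<exists>n>0. real n *\<^sub>R x \<in> section_degrees M m j \<sigma> \<Delta>"
proof -
  obtain B where B: "finite B" "B \<subseteq> M" "M \<subseteq> span B"
    and M0: "0 \<in> M" and Madd: "\<And>x y. x \<in> M \<Longrightarrow> y \<in> M \<Longrightarrow> x + y \<in> M"
    and Mscale: "\<And>x n. x \<in> M \<Longrightarrow> of_int n *\<^sub>R x \<in> M"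
    using is_lattice_basis[OF M] by metis
  have span: "span M = span B"
    using B by (simp add: span_eq order.trans[OF _ span_superset])
  have "\<exists>A. \<forall>i\<le>m. finite (A i) \<and> A i \<subseteq> rat_cochars M \<and>
    (\<forall>w\<in>dual_cone M \<sigma>. pd_eval (\<Delta> i) w = (INF v\<in>A i. ereal (v \<bullet> w)))"
    by (rule polyhedral_divisor_generators[OF M D])
  then obtain A where A: "\<And>i. i \<le> m \<Longrightarrow> finite (A i)" "\<And>i. i \<le> m \<Longrightarrow> A i \<subseteq> rat_cochars M"
    and eval: "\<And>i w. i \<le> m \<Longrightarrow> w \<in> dual_cone M \<sigma> \<Longrightarrow> pd_eval (\<Delta> i) w = (INF v\<in>A i. ereal (v \<bullet> w))"
    by blast
  have "rat_polyhedral_cone M \<sigma>" using D by (simp add: polyhedral_divisor_def)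
  from dual_cone_halfspaces[OF M this] obtain S where S: "finite S" "S \<subseteq> rat_cochars M"
    and dual: "dual_cone M \<sigma> = {w \<in> UNIV \<times> span M. \<forall>v\<in>S. 0 \<le> v \<bullet> w}"
    by blast
  define I where "I = {..m} - {j}"
  have I: "finite I" "\<And>i. i \<in> I \<Longrightarrow> i \<le> m" by (auto simp: I_def)
  \<comment> \<open>The halfspaces for \<open>\<sigma>\<^sup>\<or>\<close>, for the lower bound and for the upper bound.\<close>
  define H where "H = (\<lambda>v. (v, 0::real)) ` S \<union> (\<lambda>v. (v, 1)) ` A j \<union>
    (\<lambda>c. (\<Sum>i\<in>I. c i, - 1)) ` Pi\<^sub>E I A"
  have finH: "finite H"
    unfolding H_def using S A(1) I j by (auto intro!: finite_PiE)
  have sumA: "(\<Sum>i\<in>I. c i) \<in> rat_cochars M" if c: "c \<in> Pi\<^sub>E I A" for c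
  proof -
    have "c i \<in> rat_cochars M" if "i \<in> I" for i
      using A(2)[OF I(2)[OF that]] c that by auto
    then show ?thesis
      by (induction I rule: infinite_finite_induct) (auto simp: rat_cochars_closed)
  qed
  have H: "H \<subseteq> rat_cochars M \<times> \<rat>"
    unfolding H_def using S(2) A(2)[OF j] sumA by auto
  \<comment> \<open>Generators of \<open>(\<int> \<times> M)\<^sub>\<real>\<close> and of \<open>(\<int> \<times> M \<times> \<int>)\<^sub>\<real>\<close> as cones.\<close>
  define V\<^sub>1 where "V\<^sub>1 = (\<lambda>k. (k, 0)) ` {1, - 1 :: real} \<union> Pair 0 ` (B \<union> uminus ` B)"
  define V\<^sub>0 where "V\<^sub>0 = (\<lambda>v. (v, 0)) ` V\<^sub>1 \<union> Pair 0 ` {1, - 1 :: real}"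
  have fin: "finite V\<^sub>1" "finite V\<^sub>0"
    using B(1) by (auto simp: V\<^sub>1_def V\<^sub>0_def)
  have V\<^sub>0_UNIV: "cone_over UNIV V\<^sub>0 = (UNIV \<times> span M) \<times> UNIV"
    unfolding V\<^sub>0_def V\<^sub>1_def span using B(1)
    by (simp add: cone_over_Times[OF real_subfield_UNIV] cone_over_1_minus_1[OF real_subfield_UNIV]
        cone_over_UNIV_symmetric del: image_insert image_empty image_Un)
  define L where "L = ((\<int> :: real set) \<times> M) \<times> (\<int> :: real set)"
  have Mneg: "- b \<in> M" if "b \<in> M" for b
    using Mscale[OF that, of "- 1"] by simp
  have V\<^sub>0L: "V\<^sub>0 \<subseteq> L"
    unfolding V\<^sub>0_def V\<^sub>1_def L_def using B(2) M0 Mneg by (auto simp: zero_prod_def)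
  have L: "0 \<in> L" "\<And>x y. x \<in> L \<Longrightarrow> y \<in> L \<Longrightarrow> x + y \<in> L" "\<And>x n. x \<in> L \<Longrightarrow> of_int n *\<^sub>R x \<in> L"
    unfolding L_def using M0 Madd Mscale by (auto simp: zero_prod_def)
  have rat: "h \<bullet> x \<in> \<rat>" if hx: "h \<in> H" "x \<in> V\<^sub>0" for h x
  proof -
    obtain v q where h: "h = (v, q)" "v \<in> rat_cochars M" "q \<in> \<rat>"
      using hx(1) H by blast
    obtain w l where x: "x = (w, l)" "w \<in> \<int> \<times> M" "l \<in> \<int>"
      using hx(2) V\<^sub>0L unfolding L_def by blast
    have "v \<bullet> w \<in> \<rat>" "q * l \<in> \<rat>"
      using rat_cochars_inner[OF h(2) x(2)] h(3) x(3) Ints_subset_Rats by auto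
    then show ?thesis unfolding h x by simp
  qed
  from finitely_generated_Int_halfspaces[OF finH fin(2) rat] obtain V where V: "finite V"
    "\<And>F. real_subfield F \<Longrightarrow> {x \<in> cone_over F V\<^sub>0. \<forall>h\<in>H. 0 \<le> h \<bullet> x} = cone_over F V"
    by blast
  have iff: "(w, l) \<in> section_cone M m j \<sigma> \<Delta> \<longleftrightarrow>
      (w, l) \<in> {x \<in> cone_over UNIV V\<^sub>0. \<forall>h\<in>H. 0 \<le> h \<bullet> x}" for w l
  proof (cases "w \<in> dual_cone M \<sigma>")
    case True
    have low: "- pd_eval (\<Delta> j) w \<le> ereal l \<longleftrightarrow> (\<forall>v\<in>A j. 0 \<le> v \<bullet> w + l)"
      unfolding eval[OF j True] by (rule uminus_INF_le_iff)
    have "(\<Sum>i\<in>I. pd_eval (\<Delta> i) w) = (\<Sum>i\<in>I. INF v\<in>A i. ereal (v \<bullet> w))"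
      using eval[OF I(2) True] by (intro sum.cong) auto
    then have up: "ereal l \<le> (\<Sum>i\<in>I. pd_eval (\<Delta> i) w) \<longleftrightarrow> (\<forall>c\<in>Pi\<^sub>E I A. l \<le> (\<Sum>i\<in>I. c i) \<bullet> w)"
      using le_sum_INF_iff[OF I(1) A(1)[OF I(2)], where l = l and f = "\<lambda>v. v \<bullet> w"] by (simp add: inner_sum_left)
    have "w \<in> UNIV \<times> span M" "\<forall>v\<in>S. 0 \<le> v \<bullet> w"
      using True unfolding dual by auto
    then show ?thesis
      using True low up unfolding section_cone_def V\<^sub>0_UNIV I_def[symmetric] H_def
      by (simp add: ball_Un mem_Times_iff)
  next
    case False
    then show ?thesis
      unfolding section_cone_def V\<^sub>0_UNIV H_def by (auto simp: dual ball_Un)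
  qed
  have cone: "section_cone M m j \<sigma> \<Delta> = cone_over UNIV V"
    unfolding V(2)[OF real_subfield_UNIV, symmetric]
    by (rule set_eqI) (simp only: split_paired_all iff)
  have "\<exists>n>0. real n *\<^sub>R x \<in> section_degrees M m j \<sigma> \<Delta>" if x: "x \<in> V" for x
  proof -
    have "x \<in> cone_over \<rat> V\<^sub>0"
      using cone_over_base[OF real_subfield_Rats V(1) x] V(2)[OF real_subfield_Rats] by blast
    from cone_over_Rats_clear_denominators[OF V\<^sub>0L L this]
    obtain n where n: "n > 0" "real n *\<^sub>R x \<in> L" by blast
    obtain w l where wl: "real n *\<^sub>R x = (w, l)" "w \<in> \<int> \<times> M" "l \<in> \<int>"
      using n(2) unfolding L_def by blast
    \<comment> \<open>All values of the linear pieces; their denominators are cleared by a further multiple.\<close>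
    define R where "R = (\<lambda>v. v \<bullet> w) ` (\<Union>i\<le>m. A i)"
    have finR: "finite R" unfolding R_def using A(1) by auto
    have "R \<subseteq> \<rat>"
      unfolding R_def using A(2) rat_cochars_inner[OF _ wl(2)] by blast
    from common_denominator[OF finR this]
    obtain N where N: "N > 0" "\<And>r. r \<in> R \<Longrightarrow> real N * r \<in> \<int>"
      by blast
    define w' l' where "w' = real N *\<^sub>R w" and "l' = real N * l"
    have wl': "real (N * n) *\<^sub>R x = (w', l')"
      by (simp only: of_nat_mult scaleR_scaleR[symmetric] wl(1) scaleR_Pair w'_def l'_def real_scaleR_def)
    have inL: "(w', l') \<in> L"
      using L(3)[of "(w, l)" "int N"] wl by (simp add: w'_def l'_def L_def)
    have inC: "(w', l') \<in> section_cone M m j \<sigma> \<Delta>"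
      unfolding cone wl'[symmetric]
      using cone_over_base[OF real_subfield_UNIV V(1) x] by (intro cone_over_scale real_subfield_UNIV) auto
    then have w': "w' \<in> dual_cone M \<sigma>"
      by (simp add: section_cone_def)
    have floor: "ereal_floor (pd_eval (\<Delta> i) w') = pd_eval (\<Delta> i) w'" if "i \<le> m" for i
    proof (rule INF_finite_cases[OF A(1)[OF that], of "\<lambda>v. v \<bullet> w'"])
      assume "(INF v\<in>A i. ereal (v \<bullet> w')) = \<infinity>"
      then show ?thesis using eval[OF that w'] by (simp add: ereal_floor_def)
    next
      fix a assume a: "a \<in> A i" "(INF v\<in>A i. ereal (v \<bullet> w')) = ereal (a \<bullet> w')"
      have "a \<bullet> w \<in> R" unfolding R_def using a(1) that by blast
      from N(2)[OF this] have "a \<bullet> w' \<in> \<int>" by (simp add: w'_def)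
      then have "of_int \<lfloor>a \<bullet> w'\<rfloor> = a \<bullet> w'" by (auto elim: Ints_cases)
      then show ?thesis using eval[OF that w'] a(2) by (simp add: ereal_floor_def)
    qed
    have "(\<Sum>i\<in>{..m} - {j}. ereal_floor (pd_eval (\<Delta> i) w')) = (\<Sum>i\<in>{..m} - {j}. pd_eval (\<Delta> i) w')"
      by (intro sum.cong floor) auto
    then have "(w', l') \<in> section_degrees M m j \<sigma> \<Delta>"
      using inL inC by (simp add: section_degrees_def section_cone_def L_def floor[OF j])
    then show ?thesis
      unfolding wl'[symmetric] using N(1) n(1) by (intro exI[of _ "N * n"]) simp
  qed
  then show thesis using that V(1) cone by blast
qed

section \<open>Values of sections and the Newton-Okounkov body\<close>

text \<open>
  On \<open>\<sigma>\<^sup>\<or>\<close> the value \<open>-\<infinity>\<close> does not occur.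
\<close>

lemma ereal_floor_pd_eval:
  assumes M: "is_lattice M" and D: "polyhedral_divisor M m P \<sigma> \<Delta>"
    and i: "i \<le> m" and w: "w \<in> dual_cone M \<sigma>"
  shows "(\<exists>z. ereal_floor (pd_eval (\<Delta> i) w) = ereal (of_int z)) \<or> ereal_floor (pd_eval (\<Delta> i) w) = \<infinity>"
proof -
  obtain A where A: "finite (A i)" and eval: "pd_eval (\<Delta> i) w = (INF v\<in>A i. ereal (v \<bullet> w))"
    using polyhedral_divisor_generators[OF M D] i w by blast
  show ?thesis
    by (rule INF_finite_cases[OF A, of "\<lambda>v. v \<bullet> w"]) (auto simp: eval ereal_floor_def)
qed

lemma pd_piece_order_iff:
  fixes P :: "nat \<Rightarrow> 'k::alg_closed_field proj_line"
  assumes M: "is_lattice M" and D: "polyhedral_divisor M m P \<sigma> \<Delta>" and j: "j \<le> m" and u: "u \<in> M"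
  shows "(\<exists>f\<in>pd_piece M m P \<sigma> \<Delta> k u. f \<noteq> 0 \<and> ord_at (P j) f = l) \<longleftrightarrow>
    ((of_int k, u), of_int l) \<in> section_degrees M m j \<sigma> \<Delta>"
proof (cases "(of_int k, u) \<in> dual_cone M \<sigma>")
  case True
  have "inj_on P {..m}" using D by (simp add: polyhedral_divisor_def)
  from exists_section_of_order_iff[OF this j ereal_floor_pd_eval[OF M D _ True], where l = l]
  show ?thesis
    using True u by (simp add: pd_piece_def section_degrees_def)
next
  case False
  then show ?thesis by (auto simp: pd_piece_def section_degrees_def)
qed

lemma realize_0: "realize \<iota> \<xi> 0 = 0"
  by (simp add: realize_def)

text \<open>
  The map \<open>\<rho>\<close>, with the grading by \<open>k\<close> carried along.
\<close>

definition degree_projection :: "('m \<Rightarrow> 'g::real_vector) \<Rightarrow> 'g \<Rightarrow> (real \<times> 'm) \<times> real \<Rightarrow> real \<times> 'g" where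
  "degree_projection \<psi> \<gamma> = (\<lambda>((k, u), l). (k, \<psi> u + l *\<^sub>R \<gamma>))"

lemma linear_degree_projection: "linear \<psi> \<Longrightarrow> linear (degree_projection \<psi> \<gamma>)"
  unfolding degree_projection_def
  by (intro linearI) (auto simp: linear_add linear_scale scaleR_add_left scaleR_add_right)

text \<open>
  As the valuation of a section is the minimum over its homogeneous components, it is the value of one
  of them; conversely each homogeneous component of a section is itself a section.  The values are therefore
  those of the sections \<open>f \<cdot> \<chi>\<^sup>u\<close>, and these depend only on the degree and the order of \<open>f\<close> at \<open>P j\<close>.
\<close>

lemma values_eq_degrees:
  fixes M :: "'m::euclidean_space set"
    and \<iota> :: "'k::alg_closed_field poly fract \<Rightarrow> 'f::field"
    and \<psi> :: "'m \<Rightarrow> 'g::euclidean_space"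
  assumes M: "is_lattice M" and K: "function_field_identification M \<iota> \<xi>"
    and D: "encodes_section_ring M \<iota> \<xi> X D m P \<sigma> \<Delta>"
    and \<nu>: "is_psi_Q_gamma_valuation M \<iota> \<xi> \<Gamma> le \<psi> (P j) \<gamma> \<nu>"
    and j: "j \<le> m"
  shows "{(of_int k, \<nu> s) | k s. s \<in> section_ring X D k \<and> s \<noteq> 0} =
    degree_projection \<psi> \<gamma> ` section_degrees M m j \<sigma> \<Delta>"
proof -
  have pd: "polyhedral_divisor M m P \<sigma> \<Delta>"
    and sec: "\<And>k. section_ring X D k = realize \<iota> \<xi> `
      {a \<in> group_algebra UNIV M. \<forall>u\<in>M. Poly_Mapping.lookup a u \<in> pd_piece M m P \<sigma> \<Delta> k u}"
    using D by (simp_all add: encodes_section_ring_def)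
  have val: "\<exists>u\<in>Poly_Mapping.keys a. \<nu> (realize \<iota> \<xi> a) = \<psi> u + of_int (ord_at (P j) (Poly_Mapping.lookup a u)) *\<^sub>R \<gamma>"
    if "a \<in> group_algebra UNIV M" "a \<noteq> 0" for a
    using \<nu> that unfolding is_psi_Q_gamma_valuation_def Let_def by blast
  show ?thesis
  proof (intro subset_antisym subsetI)
    fix x assume "x \<in> {(real_of_int k, \<nu> s) | k s. s \<in> section_ring X D k \<and> s \<noteq> 0}"
    then obtain k s where x: "x = (of_int k, \<nu> s)" and s: "s \<in> section_ring X D k" "s \<noteq> 0"
      by blast
    then obtain a where a: "s = realize \<iota> \<xi> a" "a \<in> group_algebra UNIV M"
      "\<And>u. u \<in> M \<Longrightarrow> Poly_Mapping.lookup a u \<in> pd_piece M m P \<sigma> \<Delta> k u"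
      unfolding sec by blast
    have "a \<noteq> 0" using s(2) a(1) realize_0 by metis
    then obtain u where u: "u \<in> Poly_Mapping.keys a"
      "\<nu> s = \<psi> u + of_int (ord_at (P j) (Poly_Mapping.lookup a u)) *\<^sub>R \<gamma>"
      using val a by blast
    have uM: "u \<in> M" using u(1) a(2) by (auto simp: group_algebra_def)
    have "Poly_Mapping.lookup a u \<noteq> 0" using u(1) by (simp add: in_keys_iff)
    then have "((of_int k, u), of_int (ord_at (P j) (Poly_Mapping.lookup a u))) \<in> section_degrees M m j \<sigma> \<Delta>"
      using pd_piece_order_iff[OF M pd j uM] a(3)[OF uM] by blast
    then show "x \<in> degree_projection \<psi> \<gamma> ` section_degrees M m j \<sigma> \<Delta>"
      unfolding x u(2) by (rule rev_image_eqI) (simp add: degree_projection_def)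
  next
    fix x assume "x \<in> degree_projection \<psi> \<gamma> ` section_degrees M m j \<sigma> \<Delta>"
    then obtain k u l where deg: "((of_int k, u), of_int l) \<in> section_degrees M m j \<sigma> \<Delta>"
      and uM: "u \<in> M" and x: "x = (of_int k, \<psi> u + of_int l *\<^sub>R \<gamma>)"
      by (auto simp: section_degrees_def degree_projection_def elim!: Ints_cases)
    obtain f where f: "f \<in> pd_piece M m P \<sigma> \<Delta> k u" "f \<noteq> 0" "ord_at (P j) f = l"
      using deg pd_piece_order_iff[OF M pd j uM] by blast
    define a where "a = Poly_Mapping.single u f"
    have a: "a \<in> group_algebra UNIV M"
      using uM f(2) by (simp add: a_def group_algebra_def)
    have "a \<noteq> 0" using f(2) by (metis a_def lookup_single_eq lookup_zero)
    have "0 \<in> pd_piece M m P \<sigma> \<Delta> k u'" for u'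
      by (simp add: pd_piece_def H0_P1_def)
    then have "Poly_Mapping.lookup a u' \<in> pd_piece M m P \<sigma> \<Delta> k u'" for u'
      using f(1) by (auto simp: a_def lookup_single when_def)
    then have "realize \<iota> \<xi> a \<in> section_ring X D k"
      unfolding sec using a by blast
    moreover have "realize \<iota> \<xi> a \<noteq> 0"
      using K a \<open>a \<noteq> 0\<close> unfolding function_field_identification_def by blast
    moreover have "\<nu> (realize \<iota> \<xi> a) = \<psi> u + of_int l *\<^sub>R \<gamma>"
      using val[OF a \<open>a \<noteq> 0\<close>] f by (simp add: a_def)
    ultimately show "x \<in> {(real_of_int k, \<nu> s) | k s. s \<in> section_ring X D k \<and> s \<noteq> 0}"
      unfolding x by force
  qed
qed

text \<open>
  The semigroup and the finite generating set of the real cone span the same cone as soon as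
  every generator has a multiple in the semigroup.
\<close>

lemma convex_cone_hull_eq_of_generators:
  fixes S C :: "'a::euclidean_space set"
  assumes V: "finite V" "C = cone_over UNIV V" and S: "S \<subseteq> C"
    and gen: "\<And>x. x \<in> V \<Longrightarrow> \<exists>n>0. real n *\<^sub>R x \<in> S"
  shows "convex_cone hull S = convex_cone hull V" "convex_cone hull V = C"
proof -
  show C: "convex_cone hull V = C"
    using V cone_over_UNIV by blast
  show "convex_cone hull S = convex_cone hull V"
  proof
    show "convex_cone hull S \<subseteq> convex_cone hull V"
      using S C by (intro hull_minimal convex_cone_convex_cone_hull) auto
    have "x \<in> convex_cone hull S" if x: "x \<in> V" for x
    proof -
      obtain n where n: "n > 0" "real n *\<^sub>R x \<in> S" using gen[OF x] by blast
      then have "(1 / real n) *\<^sub>R (real n *\<^sub>R x) \<in> convex_cone hull S"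
        by (intro convex_cone_hull_mul hull_inc) auto
      then show ?thesis using n(1) by simp
    qed
    then show "convex_cone hull V \<subseteq> convex_cone hull S"
      by (intro hull_minimal convex_cone_convex_cone_hull) auto
  qed
qed

theorem theorem5p10:
  fixes M :: "'m::euclidean_space set"
    and \<iota> :: "'k::alg_closed_field poly fract \<Rightarrow> 'f::field"
    and \<xi> :: "'m \<Rightarrow> 'f"
    and X :: "'f set set"
    and D :: "'f set \<Rightarrow> int"
    and m j :: nat
    and P :: "nat \<Rightarrow> 'k proj_line"
    and \<sigma> :: "(real \<times> 'm) set"
    and \<Delta> :: "nat \<Rightarrow> (real \<times> 'm) set"
    and \<Gamma> :: "'g::euclidean_space set"
    and le :: "'g \<Rightarrow> 'g \<Rightarrow> bool"
    and \<psi> :: "'m \<Rightarrow> 'g"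
    and Q :: "'k proj_line"
    and \<gamma> :: 'g
    and \<nu> :: "'f \<Rightarrow> 'g"
  assumes "is_lattice M"
    and "projective_rational_complexity_one_T_variety M \<iota> \<xi> X"
    and "T_invariant_divisor M \<iota> \<xi> X D"
    and "encodes_section_ring M \<iota> \<xi> X D m P \<sigma> \<Delta>"
    and "is_lattice \<Gamma>" and "total_group_order \<Gamma> le"
    and "linear \<psi>" and "\<psi> ` M \<subseteq> \<Gamma>"
    and "\<gamma> \<in> \<Gamma>" and "le 0 \<gamma>"
    and "is_psi_Q_gamma_valuation M \<iota> \<xi> \<Gamma> le \<psi> Q \<gamma> \<nu>"
    and "j \<le> m" and "Q = P j"
  shows "newton_okounkov_body X D \<nu> =
    (\<lambda>(u, l). \<psi> u + l *\<^sub>R \<gamma>) `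
      {(u, v). u \<in> box_D M \<sigma> \<and>
         - pd_eval (\<Delta> j) (1, u) \<le> ereal v \<and>
         ereal v \<le> (\<Sum>i\<in>{..m} - {j}. pd_eval (\<Delta> i) (1, u))}"
proof -
  define S C \<phi> where "S = section_degrees M m j \<sigma> \<Delta>" and "C = section_cone M m j \<sigma> \<Delta>"
    and "\<phi> = degree_projection \<psi> \<gamma>"
  have pd: "polyhedral_divisor M m P \<sigma> \<Delta>"
    using assms(4) by (simp add: encodes_section_ring_def)
  have K: "function_field_identification M \<iota> \<xi>"
    using assms(2) by (simp add: projective_rational_complexity_one_T_variety_def)
  have lin: "linear \<phi>"
    unfolding \<phi>_def using assms(7) by (rule linear_degree_projection)
  obtain V where V: "finite V" "C = cone_over UNIV V" "\<And>x. x \<in> V \<Longrightarrow> \<exists>n>0. real n *\<^sub>R x \<in> S"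
    using section_cone_generators[OF assms(1) pd assms(12)] unfolding C_def S_def by metis
  have "S \<subseteq> C"
    unfolding S_def C_def by (rule section_degrees_subset)
  from convex_cone_hull_eq_of_generators[OF V(1,2) this V(3)]
  have hulls: "convex_cone hull S = convex_cone hull V" "convex_cone hull V = C"
    by blast+
  have "value_cone (section_ring X D) \<nu> = closure (convex_cone hull (\<phi> ` S))"
    unfolding value_cone_def S_def \<phi>_def
    using values_eq_degrees[OF assms(1) K assms(4) assms(11)[unfolded assms(13)] assms(12)] by simp
  also have "convex_cone hull (\<phi> ` S) = \<phi> ` (convex_cone hull S)"
    by (rule convex_cone_hull_linear_image[OF lin])
  also have "\<dots> = convex_cone hull (\<phi> ` V)"
    unfolding hulls(1) by (rule convex_cone_hull_linear_image[OF lin, symmetric])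
  \<comment> \<open>Linear images of closed cones need not be closed; those of finitely generated cones are.\<close>
  also have "closure \<dots> = convex_cone hull (\<phi> ` V)"
    using V(1) by (intro closure_closed closed_convex_cone_hull) simp
  also have "\<dots> = \<phi> ` C"
    unfolding convex_cone_hull_linear_image[OF lin] hulls(2) ..
  finally have "newton_okounkov_body X D \<nu> = snd ` (\<phi> ` C \<inter> fst -` {1})"
    unfolding newton_okounkov_body_def by simp
  also have "\<dots> = (\<lambda>(u, l). \<psi> u + l *\<^sub>R \<gamma>) ` {(u, l). ((1, u), l) \<in> C}"
    unfolding \<phi>_def degree_projection_def by (force simp: image_iff)
  also have "{(u, l). ((1, u), l) \<in> C} = {(u, v). u \<in> box_D M \<sigma> \<and>
         - pd_eval (\<Delta> j) (1, u) \<le> ereal v \<and>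
         ereal v \<le> (\<Sum>i\<in>{..m} - {j}. pd_eval (\<Delta> i) (1, u))}"
    unfolding C_def section_cone_def box_D_def dual_cone_def by auto
  finally show ?thesis .
qed

end
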